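(* Any two quasipositive factorizations of a positive braid $X\in\mathbf{B}_3$ are Hurwitz equivalent.
   Context: $\mathbf{B}_3=\langle\sigma_1,\sigma_2\mid\sigma_1\sigma_2\sigma_1=\sigma_2\sigma_1\sigma_2\rangle$ is the group of braids with three strings. A braid in $\mathbf{B}_3$ is positive if it is represented by a word over the alphabet $\{\sigma_1,\sigma_2\}$ (no inverses). A quasipositive factorization of $X\in\mathbf{B}_3$ is a tuple $(X_1,\dots,X_k)\in\mathbf{B}_3^k$ such that $X_1\cdots X_k=X$ and each $X_i$ is conjugate in $\mathbf{B}_3$ to $\sigma_1$. (The length $k$ is determined by $X$.) For a group $G$ and $1\le i<k$, define $\Sigma_i:G^k\to G^k$ by $\Sigma_i(X_1,\dots,X_k)=(Y_1,\dots,Y_k)$ where $(Y_i,Y_{i+1})=(X_iX_{i+1}X_i^{-1},X_i)$ and $Y_j=X_j$ for $j\notin\{i,i+1\}$. These maps are invertible, and $\sigma_i\mapsto\Sigma_i$ defines an action of the braid group $\mathbf{B}_k$ on $G^k$, called the Hurwitz action. Two tuples in $\mathbf{B}_3^k$ are Hurwitz equivalent if they lie in the same orbit of this action (with $G=\mathbf{B}_3$). *)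

theory Defs
  imports "HOL-Algebra.Group_Action"
begin

section \<open>Groups given by generators and relations\<close>

text \<open>
  A word is a list of letters \<open>(s, b)\<close>, where \<open>(s, True)\<close> stands for the generator
  \<open>s\<close> and \<open>(s, False)\<close> for its formal inverse.  A relation \<open>u = v\<close> is a pair \<open>(u, v)\<close>.
\<close>

type_synonym 'a word = "('a \<times> bool) list"

definition words :: "'a set \<Rightarrow> 'a word set" where
  "words S = lists (S \<times> UNIV)"

definition word_inv :: "'a word \<Rightarrow> 'a word" where
  "word_inv w = rev (map (\<lambda>(s, b). (s, \<not> b)) w)"

inductive pres_eq :: "'a set \<Rightarrow> ('a word \<times> 'a word) set \<Rightarrow> 'a word \<Rightarrow> 'a word \<Rightarrow> bool"
  for S R where
  refl: "w \<in> words S \<Longrightarrow> pres_eq S R w w"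
| sym: "pres_eq S R v w \<Longrightarrow> pres_eq S R w v"
| trans: "pres_eq S R u v \<Longrightarrow> pres_eq S R v w \<Longrightarrow> pres_eq S R u w"
| cancel: "u \<in> words S \<Longrightarrow> v \<in> words S \<Longrightarrow> s \<in> S \<Longrightarrow>
    pres_eq S R (u @ [(s, b), (s, \<not> b)] @ v) (u @ v)"
| relator: "u \<in> words S \<Longrightarrow> v \<in> words S \<Longrightarrow> (l, r) \<in> R \<Longrightarrow> l \<in> words S \<Longrightarrow> r \<in> words S \<Longrightarrow>
    pres_eq S R (u @ l @ v) (u @ r @ v)"

definition pres_class :: "'a set \<Rightarrow> ('a word \<times> 'a word) set \<Rightarrow> 'a word \<Rightarrow> 'a word set" where
  "pres_class S R w = {v. pres_eq S R w v}"

definition presented_group :: "'a set \<Rightarrow> ('a word \<times> 'a word) set \<Rightarrow> 'a word set monoid" where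
  "presented_group S R =
    \<lparr>carrier = words S // {(v, w). pres_eq S R v w},
     mult = \<lambda>A B. \<Union>a\<in>A. \<Union>b\<in>B. pres_class S R (a @ b),
     one = pres_class S R []\<rparr>"

lemma words_simps [simp]:
  "[] \<in> words S"
  "x # w \<in> words S \<longleftrightarrow> fst x \<in> S \<and> w \<in> words S"
  "v @ w \<in> words S \<longleftrightarrow> v \<in> words S \<and> w \<in> words S"
  by (cases x; auto simp: words_def)+

lemma word_inv_simps [simp]:
  "word_inv [] = []"
  "word_inv (x # w) = word_inv w @ [(fst x, \<not> snd x)]"
  by (auto simp: word_inv_def split: prod.splits)

lemma word_inv_words [simp]: "w \<in> words S \<Longrightarrow> word_inv w \<in> words S"
  by (induction w) auto

lemma pres_eq_words: "pres_eq S R v w \<Longrightarrow> v \<in> words S \<and> w \<in> words S"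
  by (induction rule: pres_eq.induct) auto

lemma pres_eq_context:
  assumes "pres_eq S R v w" "a \<in> words S" "b \<in> words S"
  shows "pres_eq S R (a @ v @ b) (a @ w @ b)"
  using assms
proof (induction rule: pres_eq.induct)
  case (cancel u v s c)
  then show ?case using pres_eq.cancel[of "a @ u" S "v @ b" s R c] by simp
next
  case (relator u v l r)
  then show ?case using pres_eq.relator[of "a @ u" S "v @ b" l r R] by simp
qed (auto intro: pres_eq.intros)

lemma pres_eq_append:
  assumes "pres_eq S R a a'" "pres_eq S R b b'"
  shows "pres_eq S R (a @ b) (a' @ b')"
proof -
  have "pres_eq S R (a @ b) (a' @ b)"
    using pres_eq_context[OF assms(1), of "[]" b] pres_eq_words[OF assms(2)] by simp
  moreover have "pres_eq S R (a' @ b) (a' @ b')"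
    using pres_eq_context[OF assms(2), of a' "[]"] pres_eq_words[OF assms(1)] by simp
  ultimately show ?thesis by (rule pres_eq.trans)
qed

lemma pres_eq_word_inv: "w \<in> words S \<Longrightarrow> pres_eq S R (word_inv w @ w) []"
proof (induction w)
  case (Cons x w)
  have "pres_eq S R (word_inv w @ [(fst x, \<not> snd x), (fst x, \<not> \<not> snd x)] @ w) (word_inv w @ w)"
    using Cons.prems by (intro pres_eq.cancel) auto
  with Cons show ?case by (auto intro: pres_eq.trans)
qed (auto intro: pres_eq.intros)

lemma pres_class_eq_iff:
  "w \<in> words S \<Longrightarrow> pres_class S R v = pres_class S R w \<longleftrightarrow> pres_eq S R v w"
  unfolding pres_class_def by (auto intro: pres_eq.intros)

lemma carrier_presented_group: "carrier (presented_group S R) = pres_class S R ` words S"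
  by (auto simp: presented_group_def quotient_def pres_class_def)

lemma one_presented_group: "\<one>\<^bsub>presented_group S R\<^esub> = pres_class S R []"
  by (simp add: presented_group_def)

lemma mult_presented_group:
  assumes "v \<in> words S" "w \<in> words S"
  shows "pres_class S R v \<otimes>\<^bsub>presented_group S R\<^esub> pres_class S R w = pres_class S R (v @ w)"
proof -
  have "pres_class S R (a @ b) = pres_class S R (v @ w)"
    if "a \<in> pres_class S R v" "b \<in> pres_class S R w" for a b
    using that assms
    by (subst pres_class_eq_iff) (auto simp: pres_class_def intro: pres_eq_append pres_eq.sym)
  then have "(\<Union>a\<in>pres_class S R v. \<Union>b\<in>pres_class S R w. pres_class S R (a @ b)) =
      (\<Union>a\<in>pres_class S R v. \<Union>b\<in>pres_class S R w. pres_class S R (v @ w))"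
    by (intro SUP_cong) simp_all
  moreover have "v \<in> pres_class S R v" "w \<in> pres_class S R w"
    using assms by (auto simp: pres_class_def intro: pres_eq.refl)
  ultimately show ?thesis unfolding presented_group_def monoid.select_convs by blast
qed

lemma group_presented_group: "group (presented_group S R)"
proof (rule groupI)
  fix x y assume "x \<in> carrier (presented_group S R)" "y \<in> carrier (presented_group S R)"
  then obtain v w where "v \<in> words S" "w \<in> words S" "x = pres_class S R v" "y = pres_class S R w"
    unfolding carrier_presented_group by blast
  then show "x \<otimes>\<^bsub>presented_group S R\<^esub> y \<in> carrier (presented_group S R)"
    by (simp add: carrier_presented_group mult_presented_group)
next
  fix x y z
  assume "x \<in> carrier (presented_group S R)" "y \<in> carrier (presented_group S R)"
    "z \<in> carrier (presented_group S R)"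
  then obtain u v w where "u \<in> words S" "v \<in> words S" "w \<in> words S"
    "x = pres_class S R u" "y = pres_class S R v" "z = pres_class S R w"
    unfolding carrier_presented_group by blast
  then show "x \<otimes>\<^bsub>presented_group S R\<^esub> y \<otimes>\<^bsub>presented_group S R\<^esub> z =
      x \<otimes>\<^bsub>presented_group S R\<^esub> (y \<otimes>\<^bsub>presented_group S R\<^esub> z)"
    by (simp add: mult_presented_group)
next
  show "\<one>\<^bsub>presented_group S R\<^esub> \<in> carrier (presented_group S R)"
    by (simp add: carrier_presented_group one_presented_group)
next
  fix x assume "x \<in> carrier (presented_group S R)"
  then obtain w where w: "w \<in> words S" "x = pres_class S R w"
    by (auto simp: carrier_presented_group)
  have "pres_class S R (word_inv w @ w) = pres_class S R []"
    using w pres_eq_word_inv[of w S R] by (simp add: pres_class_eq_iff)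
  then have "pres_class S R (word_inv w) \<otimes>\<^bsub>presented_group S R\<^esub> x = \<one>\<^bsub>presented_group S R\<^esub>"
    using w by (simp add: mult_presented_group one_presented_group)
  moreover have "pres_class S R (word_inv w) \<in> carrier (presented_group S R)"
    using w by (simp add: carrier_presented_group)
  ultimately show "\<exists>y\<in>carrier (presented_group S R).
      y \<otimes>\<^bsub>presented_group S R\<^esub> x = \<one>\<^bsub>presented_group S R\<^esub>" by blast
  show "\<one>\<^bsub>presented_group S R\<^esub> \<otimes>\<^bsub>presented_group S R\<^esub> x = x"
    using w by (simp add: mult_presented_group one_presented_group)
qed

text \<open>The homomorphism induced by a map of the generators that respects the relations.\<close>

definition eval_word :: "('b, 'c) monoid_scheme \<Rightarrow> ('a \<Rightarrow> 'b) \<Rightarrow> 'a word \<Rightarrow> 'b" where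
  "eval_word H f w = foldr (\<lambda>(s, b) h. (if b then f s else inv\<^bsub>H\<^esub> (f s)) \<otimes>\<^bsub>H\<^esub> h) w \<one>\<^bsub>H\<^esub>"

definition induced_hom :: "('b, 'c) monoid_scheme \<Rightarrow> ('a \<Rightarrow> 'b) \<Rightarrow> 'a word set \<Rightarrow> 'b" where
  "induced_hom H f A = the_elem (eval_word H f ` A)"

lemma eval_word_simps [simp]:
  "eval_word H f [] = \<one>\<^bsub>H\<^esub>"
  "eval_word H f (x # w) = (if snd x then f (fst x) else inv\<^bsub>H\<^esub> (f (fst x))) \<otimes>\<^bsub>H\<^esub> eval_word H f w"
  by (auto simp: eval_word_def split: prod.splits)

context group
begin

lemma eval_word_closed: "f \<in> S \<rightarrow> carrier G \<Longrightarrow> w \<in> words S \<Longrightarrow> eval_word G f w \<in> carrier G"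
  by (induction w) auto

lemma eval_word_append:
  assumes "f \<in> S \<rightarrow> carrier G" "w \<in> words S"
  shows "v \<in> words S \<Longrightarrow> eval_word G f (v @ w) = eval_word G f v \<otimes> eval_word G f w"
proof (induction v)
  case (Cons x v)
  then have "f (fst x) \<in> carrier G" using assms by auto
  with Cons show ?case using assms by (auto simp: m_assoc eval_word_closed)
qed (use assms in \<open>auto simp: eval_word_closed\<close>)

lemma eval_word_respects:
  assumes f: "f \<in> S \<rightarrow> carrier G"
    and R: "\<And>l r. (l, r) \<in> R \<Longrightarrow> eval_word G f l = eval_word G f r"
    and "pres_eq S R v w"
  shows "eval_word G f v = eval_word G f w"
  using assms(3)
proof (induction rule: pres_eq.induct)
  case (cancel u v s b)
  then have "f s \<in> carrier G" using f by auto
  then have "eval_word G f ([(s, b), (s, \<not> b)] @ v) = eval_word G f v"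
    using eval_word_closed[OF f, of v] cancel by (cases b) (simp_all add: m_assoc[symmetric])
  then show ?case
    using cancel eval_word_append[OF f, of v u]
      eval_word_append[OF f, of "[(s, b), (s, \<not> b)] @ v" u] by simp
next
  case (relator u v l r)
  then show ?case using R[of l r] by (simp add: eval_word_append[OF f])
qed auto

lemma induced_hom_pres_class:
  assumes f: "f \<in> S \<rightarrow> carrier G"
    and R: "\<And>l r. (l, r) \<in> R \<Longrightarrow> eval_word G f l = eval_word G f r"
    and w: "w \<in> words S"
  shows "induced_hom G f (pres_class S R w) = eval_word G f w"
proof -
  have "eval_word G f v = eval_word G f w" if "v \<in> pres_class S R w" for v
    using that eval_word_respects[OF f R] by (auto simp: pres_class_def)
  moreover have "w \<in> pres_class S R w"
    using w by (auto simp: pres_class_def intro: pres_eq.refl)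
  ultimately have "eval_word G f ` pres_class S R w = {eval_word G f w}" by blast
  then show ?thesis by (simp add: induced_hom_def)
qed

lemma induced_hom_hom:
  assumes f: "f \<in> S \<rightarrow> carrier G"
    and R: "\<And>l r. (l, r) \<in> R \<Longrightarrow> eval_word G f l = eval_word G f r"
  shows "induced_hom G f \<in> hom (presented_group S R) G"
  by (rule homI)
     (auto simp: carrier_presented_group mult_presented_group induced_hom_pres_class[OF f R]
        eval_word_closed[OF f] eval_word_append[OF f])

end


section \<open>Braid groups\<close>

definition braid_relations :: "nat \<Rightarrow> (nat word \<times> nat word) set" where
  "braid_relations n =
    {([(i, True), (i + 1, True), (i, True)], [(i + 1, True), (i, True), (i + 1, True)]) | i.
       1 \<le> i \<and> i + 1 < n} \<union>
    {([(i, True), (j, True)], [(j, True), (i, True)]) | i j. 1 \<le> i \<and> i + 2 \<le> j \<and> j < n}"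

definition braid_group :: "nat \<Rightarrow> nat word set monoid" where
  "braid_group n = presented_group {1..<n} (braid_relations n)"

definition braid_of :: "nat \<Rightarrow> nat word \<Rightarrow> nat word set" where
  "braid_of n w = pres_class {1..<n} (braid_relations n) w"

abbreviation \<sigma> :: "nat \<Rightarrow> nat \<Rightarrow> nat word set" where
  "\<sigma> n i \<equiv> braid_of n [(i, True)]"

definition positive_braid :: "nat \<Rightarrow> nat word set \<Rightarrow> bool" where
  "positive_braid n X \<longleftrightarrow> (\<exists>is \<in> lists {1..<n}. X = braid_of n (map (\<lambda>i. (i, True)) is))"

lemma group_braid_group: "group (braid_group n)"
  by (simp add: braid_group_def group_presented_group)


section \<open>The Hurwitz action\<close>

definition tuples :: "('a, 'b) monoid_scheme \<Rightarrow> nat \<Rightarrow> 'a list set" where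
  "tuples G k = {xs \<in> lists (carrier G). length xs = k}"

text \<open>
  Positions in a tuple are counted from 1, but list indices from 0: the \<open>i\<close>-th move changes the
  list entries \<open>i - 1\<close> and \<open>i\<close>.
\<close>

definition hurwitz_move ::
    "('a, 'b) monoid_scheme \<Rightarrow> nat \<Rightarrow> nat \<Rightarrow> 'a list \<Rightarrow> 'a list" where
  "hurwitz_move G k i = (\<lambda>xs \<in> tuples G k.
     xs[i - 1 := xs ! (i - 1) \<otimes>\<^bsub>G\<^esub> xs ! i \<otimes>\<^bsub>G\<^esub> inv\<^bsub>G\<^esub> (xs ! (i - 1)), i := xs ! (i - 1)])"

definition hurwitz_action ::
    "('a, 'b) monoid_scheme \<Rightarrow> nat \<Rightarrow> nat word set \<Rightarrow> 'a list \<Rightarrow> 'a list" where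
  "hurwitz_action G k = induced_hom (BijGroup (tuples G k)) (hurwitz_move G k)"

definition hurwitz_equivalent :: "('a, 'b) monoid_scheme \<Rightarrow> 'a list \<Rightarrow> 'a list \<Rightarrow> bool" where
  "hurwitz_equivalent G xs ys \<longleftrightarrow>
     (\<exists>k. xs \<in> tuples G k \<and> ys \<in> tuples G k \<and>
          ys \<in> orbit (braid_group k) (hurwitz_action G k) xs)"

context group
begin

lemma tuples_nth: "xs \<in> tuples G k \<Longrightarrow> i < k \<Longrightarrow> xs ! i \<in> carrier G"
  by (auto simp: tuples_def)

lemma tuples_update: "xs \<in> tuples G k \<Longrightarrow> x \<in> carrier G \<Longrightarrow> xs[i := x] \<in> tuples G k"
  using set_update_subset_insert[of xs i x] by (auto simp: tuples_def)

lemma hurwitz_move_closed: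
  assumes "xs \<in> tuples G k" "i \<in> {1..<k}"
  shows "hurwitz_move G k i xs \<in> tuples G k"
  using assms by (auto simp: hurwitz_move_def intro!: tuples_update tuples_nth m_closed inv_closed)

lemma hurwitz_move_Bij:
  assumes i: "i \<in> {1..<k}"
  shows "hurwitz_move G k i \<in> Bij (tuples G k)"
proof -
  define g where "g = (\<lambda>xs. xs[i - 1 := xs ! i, i := inv (xs ! i) \<otimes> xs ! (i - 1) \<otimes> xs ! i])"
  have g: "g xs \<in> tuples G k" if "xs \<in> tuples G k" for xs
    using that i unfolding g_def by (auto intro!: tuples_update tuples_nth m_closed inv_closed)
  have "g (hurwitz_move G k i xs) = xs \<and> hurwitz_move G k i (g xs) = xs"
    if xs: "xs \<in> tuples G k" for xs
  proof -
    have len: "length xs = k" using xs by (auto simp: tuples_def)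
    obtain j where j: "i = Suc j" using i by (cases i) auto
    define a b where "a = xs ! j" and "b = xs ! Suc j"
    have c: "a \<in> carrier G" "b \<in> carrier G"
      using xs i j by (auto simp: a_def b_def intro: tuples_nth)
    have eqs: "inv a \<otimes> (a \<otimes> b \<otimes> inv a) \<otimes> a = b" "b \<otimes> (inv b \<otimes> a \<otimes> b) \<otimes> inv b = a"
      using c by (simp_all add: m_assoc) (simp_all add: m_assoc[symmetric])
    have upd: "xs[j := a] = xs" "xs[Suc j := b] = xs" by (simp_all add: a_def b_def)
    have "g (hurwitz_move G k i xs) = xs"
      using xs i j len eqs upd
      by (simp add: g_def hurwitz_move_def a_def[symmetric] b_def[symmetric] list_update_swap[of "Suc j" j])
    moreover have "hurwitz_move G k i (g xs) = xs"
      using g[OF xs] i j len eqs upd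
      by (simp add: g_def hurwitz_move_def a_def[symmetric] b_def[symmetric] list_update_swap[of "Suc j" j])
    ultimately show ?thesis ..
  qed
  then have "bij_betw (hurwitz_move G k i) (tuples G k) (tuples G k)"
    using hurwitz_move_closed i g by (intro bij_betwI[where g = g]) auto
  then show ?thesis by (simp add: Bij_def hurwitz_move_def)
qed

lemma hurwitz_move_braid:
  assumes xs: "xs \<in> tuples G k" and i: "1 \<le> i" "i + 1 < k"
  shows "hurwitz_move G k i (hurwitz_move G k (i + 1) (hurwitz_move G k i xs)) =
    hurwitz_move G k (i + 1) (hurwitz_move G k i (hurwitz_move G k (i + 1) xs))"
proof -
  have len: "length xs = k" using xs by (auto simp: tuples_def)
  obtain j where j: "i = Suc j" using i by (cases i) auto
  define a b c where "a = xs ! j" and "b = xs ! Suc j" and "c = xs ! Suc (Suc j)"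
  have cl: "a \<in> carrier G" "b \<in> carrier G" "c \<in> carrier G"
    using xs i j by (auto simp: a_def b_def c_def intro: tuples_nth)
  have move: "hurwitz_move G k (Suc m) ys =
      ys[m := ys ! m \<otimes> ys ! Suc m \<otimes> inv (ys ! m), Suc m := ys ! m]"
    if "ys \<in> tuples G k" for m ys
    using that by (simp add: hurwitz_move_def)
  have "inv a \<otimes> (a \<otimes> c) = c" 
    using cl by (simp add: m_assoc[symmetric])
  then have eq: "a \<otimes> b \<otimes> inv a \<otimes> (a \<otimes> c \<otimes> inv a) \<otimes> inv (a \<otimes> b \<otimes> inv a) =
      a \<otimes> (b \<otimes> c \<otimes> inv b) \<otimes> inv a"
    using cl by (simp add: m_assoc inv_mult_group)
       (simp add: m_assoc[symmetric])
  have L: "hurwitz_move G k i (hurwitz_move G k (i + 1) (hurwitz_move G k i xs)) =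
      xs[j := a \<otimes> (b \<otimes> c \<otimes> inv b) \<otimes> inv a, Suc j := a \<otimes> b \<otimes> inv a, Suc (Suc j) := a]"
    using xs i j len cl eq
    by (simp add: move tuples_update a_def[symmetric] b_def[symmetric] c_def[symmetric]
        list_update_swap[of "Suc j" j] list_update_swap[of "Suc (Suc j)" j]
        list_update_swap[of "Suc (Suc j)" "Suc j"])
  have R: "hurwitz_move G k (i + 1) (hurwitz_move G k i (hurwitz_move G k (i + 1) xs)) =
      xs[j := a \<otimes> (b \<otimes> c \<otimes> inv b) \<otimes> inv a, Suc j := a \<otimes> b \<otimes> inv a, Suc (Suc j) := a]"
    using xs i j len cl
    by (simp add: move tuples_update a_def[symmetric] b_def[symmetric] c_def[symmetric]
        list_update_swap[of "Suc j" j] list_update_swap[of "Suc (Suc j)" j]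
        list_update_swap[of "Suc (Suc j)" "Suc j"])
  show ?thesis unfolding L R ..
qed

lemma hurwitz_move_commute:
  assumes xs: "xs \<in> tuples G k" and i: "1 \<le> i" "i + 2 \<le> j" "j < k"
  shows "hurwitz_move G k i (hurwitz_move G k j xs) = hurwitz_move G k j (hurwitz_move G k i xs)"
proof -
  have len: "length xs = k" using xs by (auto simp: tuples_def)
  have c: "xs ! (i - 1) \<in> carrier G" "xs ! i \<in> carrier G" "xs ! (j - 1) \<in> carrier G" "xs ! j \<in> carrier G"
    using xs i by (auto intro: tuples_nth)
  note closed = tuples_update m_closed inv_closed
  show ?thesis
    using xs i len c
    by (intro nth_equalityI)
       (auto simp: hurwitz_move_def nth_list_update closed)
qed

lemma hurwitz_moves_respect:
  assumes "(l, r) \<in> braid_relations k"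
  shows "eval_word (BijGroup (tuples G k)) (hurwitz_move G k) l =
    eval_word (BijGroup (tuples G k)) (hurwitz_move G k) r"
proof -
  have B: "hurwitz_move G k i \<in> Bij (tuples G k)" if "1 \<le> i" "i < k" for i
    using that by (intro hurwitz_move_Bij) auto
  have I: "compose (tuples G k) (hurwitz_move G k i) (\<lambda>xs \<in> tuples G k. xs) = hurwitz_move G k i"
    for i
    by (auto simp: compose_def hurwitz_move_def fun_eq_iff)
  from assms consider
    (braid) i where "1 \<le> i" "i + 1 < k" "l = [(i, True), (i + 1, True), (i, True)]"
      "r = [(i + 1, True), (i, True), (i + 1, True)]"
  | (comm) i j where "1 \<le> i" "i + 2 \<le> j" "j < k" "l = [(i, True), (j, True)]"
      "r = [(j, True), (i, True)]"
    unfolding braid_relations_def by blast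
  then show ?thesis
  proof cases
    case braid
    have "compose (tuples G k) (hurwitz_move G k i)
            (compose (tuples G k) (hurwitz_move G k (i + 1)) (hurwitz_move G k i)) =
          compose (tuples G k) (hurwitz_move G k (i + 1))
            (compose (tuples G k) (hurwitz_move G k i) (hurwitz_move G k (i + 1)))"
      using braid hurwitz_move_braid
      by (intro extensionalityI[OF compose_extensional compose_extensional]) (auto simp: compose_eq)
    then show ?thesis
      using braid B by (simp add: BijGroup_def compose_Bij id_Bij I)
  next
    case comm
    have "compose (tuples G k) (hurwitz_move G k i) (hurwitz_move G k j) =
          compose (tuples G k) (hurwitz_move G k j) (hurwitz_move G k i)"
      using comm hurwitz_move_commute
      by (intro extensionalityI[OF compose_extensional compose_extensional]) (auto simp: compose_eq)
    then show ?thesis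
      using comm B by (simp add: BijGroup_def compose_Bij id_Bij I)
  qed
qed

lemma hurwitz_move_BijGroup: "hurwitz_move G k \<in> {1..<k} \<rightarrow> carrier (BijGroup (tuples G k))"
  using hurwitz_move_Bij by (auto simp: BijGroup_def)

theorem group_action_hurwitz:
  "group_action (braid_group k) (tuples G k) (hurwitz_action G k)"
proof -
  have "induced_hom (BijGroup (tuples G k)) (hurwitz_move G k)
      \<in> hom (presented_group {1..<k} (braid_relations k)) (BijGroup (tuples G k))"
    using hurwitz_moves_respect
    by (intro group.induced_hom_hom group_BijGroup hurwitz_move_BijGroup)
  then show ?thesis
    unfolding group_action_def group_hom_def group_hom_axioms_def hurwitz_action_def
    using group_braid_group[of k] group_BijGroup by (simp add: braid_group_def)
qed

lemma hurwitz_action_generator: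
  assumes i: "i \<in> {1..<k}"
  shows "hurwitz_action G k (\<sigma> k i) = hurwitz_move G k i"
proof -
  interpret B: group "BijGroup (tuples G k)" by (rule group_BijGroup)
  have "hurwitz_move G k i \<in> carrier (BijGroup (tuples G k))"
    using hurwitz_move_BijGroup i by blast
  moreover have "induced_hom (BijGroup (tuples G k)) (hurwitz_move G k)
      (pres_class {1..<k} (braid_relations k) [(i, True)]) =
    eval_word (BijGroup (tuples G k)) (hurwitz_move G k) [(i, True)]"
    using i hurwitz_moves_respect
    by (intro B.induced_hom_pres_class hurwitz_move_BijGroup) auto
  ultimately show ?thesis
    by (simp add: hurwitz_action_def braid_of_def)
qed

end


section \<open>Quasipositive factorizations\<close>

definition conjugate_in :: "('a, 'b) monoid_scheme \<Rightarrow> 'a \<Rightarrow> 'a \<Rightarrow> bool" where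
  "conjugate_in G x y \<longleftrightarrow> (\<exists>g \<in> carrier G. x = g \<otimes>\<^bsub>G\<^esub> y \<otimes>\<^bsub>G\<^esub> inv\<^bsub>G\<^esub> g)"

definition quasipositive_factorization :: "nat word set \<Rightarrow> nat word set list \<Rightarrow> bool" where
  "quasipositive_factorization X Xs \<longleftrightarrow>
     set Xs \<subseteq> carrier (braid_group 3) \<and>
     foldr (\<otimes>\<^bsub>braid_group 3\<^esub>) Xs \<one>\<^bsub>braid_group 3\<^esub> = X \<and>
     (\<forall>Y \<in> set Xs. conjugate_in (braid_group 3) Y (\<sigma> 3 1))"

end

theory Submission
  imports Defs "HOL-Algebra.Elementary_Groups" "HOL-Library.Sublist"
begin

text \<open>
  Besides \<open>\<sigma>\<^sub>1\<close> and \<open>\<sigma>\<^sub>2\<close>, consider \<open>\<sigma>\<^sub>2\<^sup>-\<^sup>1 \<sigma>\<^sub>1 \<sigma>\<^sub>2\<close>.  These three atoms are conjugate to each other,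
  and arranged in a cycle \<open>t\<^sub>0, t\<^sub>1, t\<^sub>2\<close>, they satisfy \<open>t\<^sub>0 t\<^sub>1 = t\<^sub>1 t\<^sub>2 = t\<^sub>2 t\<^sub>0 = \<delta>\<close>.  Every braid on
  three strings has the form \<open>w \<delta>\<^sup>p\<close> with an integer \<open>p\<close> and a word \<open>w\<close> in the atoms that contains none
  of the products equal to \<open>\<delta>\<close>.  The words \<open>w\<close> are the vertices of a trivalent tree on which the braid
  group acts by isometries, and the length \<open>|X|\<close> of a braid is the distance by which it moves the
  root.  A conjugate \<open>g\<close> of \<open>\<sigma>\<^sub>1\<close> translates along an axis by one edge, so that \<open>|g| = 2 m + 1\<close> where
  \<open>m\<close> is the distance of the axis from the root; it is an atom if \<open>m = 0\<close>.

  Consider a factorization \<open>(X\<^sub>1, \<dots>, X\<^sub>k)\<close> of a positive braid \<open>X\<close> into conjugates of \<open>\<sigma>\<^sub>1\<close>.  The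
  exponent sum of \<open>X\<close> is \<open>k\<close>, and \<open>|X| \<le> k\<close> because each generator moves the root by one edge only.
  Suppose that not all factors are atoms.  Then Hurwitz moves decrease the sum of the lengths
  (\<open>reduce_total_len\<close>):

  \<^item> If two neighbours satisfy \<open>|g h| < max |g| |h|\<close>, and are not two atoms with \<open>g h = \<delta>\<close>, a Hurwitz
    move of this pair shortens it.  For \<open>|g| \<noteq> |h|\<close> this follows from the four-point condition in
    trees; for \<open>|g| = |h| > 1\<close> the case cannot arise, because the axes belonging to conjugates of
    \<open>\<sigma>\<^sub>1\<close> that have the same nearest point to the root are equal unless they pass through the root
    (\<open>short_product\<close>).

  \<^item> If there are neighbouring atoms with product \<open>\<delta>\<close>, this pair can be moved through the whole
    tuple, and it can be turned into any other pair of atoms with product \<open>\<delta>\<close>.  Next to a factor that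
    is not an atom, one of the atoms in a suitable pair shortens this factor by conjugation
    (\<open>shorten_next_to_pair\<close>).

  \<^item> Otherwise \<open>|g h| > max |g| |h|\<close> for all neighbours; equality is excluded by parity.  Then the
    cancellations do not interact, and \<open>|X|\<close> exceeds \<open>k\<close> (\<open>len_prod_chain\<close>), a contradiction.

  So both factorizations of \<open>X\<close> are Hurwitz equivalent to tuples of atoms.  By moving all pairs with
  product \<open>\<delta>\<close> to the left, these are brought to a normal form \<open>(t\<^sub>0, t\<^sub>1, \<dots>, t\<^sub>0, t\<^sub>1, w)\<close> with a
  reduced word \<open>w\<close>, which is determined by \<open>X\<close>: the length of \<open>w\<close> is \<open>|X|\<close>, so that the number of
  pairs is \<open>(k - |X|) / 2\<close>, and then the image of the root under \<open>X\<close> gives \<open>w\<close>.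
\<close>

section \<open>The trivalent tree\<close>

datatype atom = A | B | C

fun nxt :: "atom \<Rightarrow> atom" where
  "nxt A = B" | "nxt B = C" | "nxt C = A"

abbreviation prv :: "atom \<Rightarrow> atom" where
  "prv i \<equiv> nxt (nxt i)"

lemma nxt_cycle [simp]: "nxt (nxt (nxt i)) = i"
  by (cases i) auto

lemma nxt_neq [simp]: "nxt i \<noteq> i" "i \<noteq> nxt i" "prv i \<noteq> i" "i \<noteq> prv i"
  by (cases i; simp)+

lemma nxt_eq_iff [simp]: "nxt i = nxt j \<longleftrightarrow> i = j"
  by (cases i; cases j) auto

lemma inj_nxt: "inj nxt"
  by (simp add: inj_def)

lemma map_nxt_cycle [simp]: "map nxt (map nxt (map nxt w)) = w"
  by (simp add: comp_def)

text \<open>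
  The vertices of the tree are the reduced words, and a word is joined to its extensions by one
  letter.  The letters stand for atoms \<open>t i\<close> of a group in which the product \<open>t i \<otimes> t (nxt i)\<close> is
  the same element \<open>\<delta>\<close> for all \<open>i\<close>; a word is reduced if no \<open>\<delta>\<close> can be split off from it.  The
  vertex \<open>w\<close> represents the coset of the cyclic group of \<open>\<delta>\<close> that contains the product of the
  atoms in \<open>w\<close>.  Each letter has two possible successors and the empty word has three extensions,
  so that the tree is trivalent.
\<close>

definition reduced :: "atom list \<Rightarrow> bool" where
  "reduced w \<longleftrightarrow> successively (\<lambda>i j. j \<noteq> nxt i) w"

lemma reduced_simps [simp]:
  "reduced []"
  "reduced [i]"
  "reduced (i # j # w) \<longleftrightarrow> j \<noteq> nxt i \<and> reduced (j # w)"
  "reduced (map nxt w) \<longleftrightarrow> reduced w"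
  by (auto simp: reduced_def successively_map)

lemma reduced_Cons: "reduced (i # w) \<longleftrightarrow> (w = [] \<or> hd w \<noteq> nxt i) \<and> reduced w"
  by (cases w) auto

lemma reduced_append:
  "reduced (u @ v) \<longleftrightarrow> reduced u \<and> reduced v \<and> (u = [] \<or> v = [] \<or> hd v \<noteq> nxt (last u))"
  by (auto simp: reduced_def successively_append_iff)

text \<open>
  Left multiplication of a coset by \<open>t i\<close>.  If the word begins with \<open>nxt i\<close>, the two atoms merge into
  \<open>\<delta>\<close>, and moving \<open>\<delta>\<close> to the right through the remaining word replaces each of its letters by the
  next one, because \<open>\<delta> \<otimes> t j = t (nxt j) \<otimes> \<delta>\<close>.
\<close>

definition push :: "atom \<Rightarrow> atom list \<Rightarrow> atom list" where
  "push i w = (if w \<noteq> [] \<and> hd w = nxt i then map nxt (tl w) else i # w)"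

lemma push_simps [simp]:
  "push i [] = [i]"
  "push i (nxt i # w) = map nxt w"
  "j \<noteq> nxt i \<Longrightarrow> push i (j # w) = i # j # w"
  by (auto simp: push_def)

lemma push_cases:
  obtains v where "w = nxt i # v" "push i w = map nxt v"
  | "w = [] \<or> hd w \<noteq> nxt i" "push i w = i # w"
  by (cases w) (auto simp: push_def split: if_splits)

lemma reduced_push [simp]: "reduced w \<Longrightarrow> reduced (push i w)"
  by (rule push_cases[of w i]) (auto simp: reduced_Cons)

lemma map_nxt_push: "map nxt (push i w) = push (nxt i) (map nxt w)"
  by (cases w) (auto simp: push_def)

text \<open>
  The relation that makes \<open>push\<close> an action: for every \<open>i\<close>, the product \<open>t i \<otimes> t (nxt i) = \<delta>\<close> acts by
  the rotation \<open>map nxt\<close> about the root.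
\<close>

lemma push_push_nxt:
  assumes "reduced w"
  shows "push i (push (nxt i) w) = map nxt w"
proof (rule push_cases[of w "nxt i"])
  fix v assume v: "w = nxt (nxt i) # v" "push (nxt i) w = map nxt v"
  then have "v = [] \<or> hd (map nxt v) \<noteq> nxt i"
    using assms by (auto simp: reduced_Cons hd_map)
  then have "push i (map nxt v) = i # map nxt v"
    by (auto simp: push_def)
  with v show ?thesis by simp
qed auto

lemma bij_betw_push: "bij_betw (push i) {w. reduced w} {w. reduced w}"
  unfolding bij_betw_def
proof (intro conjI inj_onI equalityI subsetI)
  fix v w assume "v \<in> {w. reduced w}" "w \<in> {w. reduced w}" "push i v = push i w"
  \<comment> \<open>Applying \<open>push (prv i)\<close> to both sides turns \<open>push i\<close> into the rotation, which is injective.\<close>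
  then have "map nxt v = map nxt w"
    using push_push_nxt[of v "prv i"] push_push_nxt[of w "prv i"] by simp
  then show "v = w" using inj_nxt by (simp add: inj_map_eq_map)
next
  fix w assume "w \<in> {w. reduced w}"
  then have "reduced (map nxt (map nxt w))" by (simp del: map_map)
  then have "w = push i (push (nxt i) (map nxt (map nxt w)))"
    using push_push_nxt[of "map nxt (map nxt w)" i] by (simp del: map_map)
  then show "w \<in> push i ` {w. reduced w}"
    using \<open>reduced (map nxt (map nxt w))\<close>
    by (intro image_eqI[of _ _ "push (nxt i) (map nxt (map nxt w))"]) (auto simp del: map_map)
qed auto

lemma length_push_le: "length (push i w) \<le> length w + 1"
  by (rule push_cases[of w i]) auto

definition tree_dist :: "atom list \<Rightarrow> atom list \<Rightarrow> nat" where
  "tree_dist u v = length u + length v - 2 * length (longest_common_prefix u v)"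

lemma lcp_le:
  "length (longest_common_prefix u v) \<le> length u"
  "length (longest_common_prefix u v) \<le> length v"
  using prefix_length_le longest_common_prefix_prefix1 longest_common_prefix_prefix2 by blast+

lemma tree_dist_eq:
  "tree_dist u v + 2 * length (longest_common_prefix u v) = length u + length v"
  using lcp_le[of u v] by (simp add: tree_dist_def)

lemma tree_dist_Nil [simp]: "tree_dist [] v = length v"
  by (simp add: tree_dist_def)

lemma lcp_commute: "longest_common_prefix u v = longest_common_prefix v u"
  by (induction u v rule: longest_common_prefix.induct) auto

lemma tree_dist_commute: "tree_dist u v = tree_dist v u"
  by (simp add: tree_dist_def lcp_commute[of u])

lemma lcp_map: "inj f \<Longrightarrow>
    longest_common_prefix (map f u) (map f v) = map f (longest_common_prefix u v)"
  by (induction u v rule: longest_common_prefix.induct) (auto simp: inj_eq)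

lemma lcp_diff: "u = [] \<or> v = [] \<or> hd u \<noteq> hd v \<Longrightarrow> longest_common_prefix u v = []"
  by (cases u; cases v) auto

lemma lcp_take: "n \<le> length (longest_common_prefix u v) \<Longrightarrow> take n u = take n v"
  by (induction u v arbitrary: n rule: longest_common_prefix.induct)
     (auto simp: take_Cons' split: if_splits)

text \<open>
  The length of the common prefix of \<open>u\<close> and \<open>v\<close> is their Gromov product with respect to the root;
  this is the 0-hyperbolicity of the tree.
\<close>

lemma lcp_ultrametric:
  "min (length (longest_common_prefix u v)) (length (longest_common_prefix v w))
     \<le> length (longest_common_prefix u w)"
proof (induction u w arbitrary: v rule: longest_common_prefix.induct)
  case (1 x u y w)
  then show ?case by (cases v) auto
next
  case "2_1"
  then show ?case by (cases v) auto
next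
  case ("2_2" u)
  then show ?case by (cases v) auto
qed

text \<open>
  If exactly one of the two words is shortened by \<open>push i\<close>, then they have no common prefix before
  and after: the shortened word begins with \<open>nxt i\<close>, hence its second letter is not \<open>prv i\<close> and does
  not become \<open>i\<close> under \<open>nxt\<close>.
\<close>

lemma tree_dist_push:
  assumes "reduced u" "reduced v"
  shows "tree_dist (push i u) (push i v) = tree_dist u v"
proof -
  have one: "tree_dist (map nxt u') (i # w) = tree_dist (nxt i # u') w"
    if "reduced (nxt i # u')" "w = [] \<or> hd w \<noteq> nxt i" for u' w
  proof -
    have "longest_common_prefix (map nxt u') (i # w) = []"
      using that(1) by (intro lcp_diff) (auto simp: reduced_Cons hd_map)
    moreover have "longest_common_prefix (nxt i # u') w = []"
      using that(2) by (intro lcp_diff) auto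
    ultimately show ?thesis by (simp add: tree_dist_def)
  qed
  show ?thesis
  proof (rule push_cases[of u i]; rule push_cases[of v i])
    fix u' v' assume "u = nxt i # u'" "push i u = map nxt u'" "v = nxt i # v'" "push i v = map nxt v'"
    then show ?thesis by (simp add: tree_dist_def lcp_map[OF inj_nxt])
  next
    fix u' assume "u = nxt i # u'" "push i u = map nxt u'" "v = [] \<or> hd v \<noteq> nxt i" "push i v = i # v"
    then show ?thesis using one[of u' v] assms by simp
  next
    fix v' assume "u = [] \<or> hd u \<noteq> nxt i" "push i u = i # u" "v = nxt i # v'" "push i v = map nxt v'"
    then show ?thesis using one[of v' u] assms by (simp add: tree_dist_commute)
  next
    assume "push i u = i # u" "push i v = i # v"
    then show ?thesis by (simp add: tree_dist_def)
  qed
qed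

lemma not_successively_obtain:
  assumes "\<not> successively P xs"
  obtains as x y bs where "xs = as @ [x, y] @ bs" "\<not> P x y"
proof -
  obtain i where i: "Suc i < length xs" "\<not> P (xs ! i) (xs ! Suc i)"
    using assms by (auto simp: successively_conv_nth)
  have "xs = take i xs @ [xs ! i, xs ! Suc i] @ drop (Suc (Suc i)) xs"
    using i(1) by (metis Cons_nth_drop_Suc Suc_lessD append_Cons append_Nil append_take_drop_id)
  then show thesis using that i(2) by blast
qed

section \<open>Hurwitz moves\<close>

context group
begin

lemma cancel_left [simp]:
  assumes "x \<in> carrier G" "y \<in> carrier G"
  shows "x \<otimes> (inv x \<otimes> y) = y" "inv x \<otimes> (x \<otimes> y) = y"
  using assms by (simp_all add: m_assoc[symmetric])

definition conjugate :: "'a \<Rightarrow> 'a \<Rightarrow> 'a" where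
  "conjugate x g = x \<otimes> g \<otimes> inv x"

lemma conjugate_closed [simp]: "x \<in> carrier G \<Longrightarrow> g \<in> carrier G \<Longrightarrow> conjugate x g \<in> carrier G"
  by (simp add: conjugate_def)

lemma conjugate_mult:
  "x \<in> carrier G \<Longrightarrow> y \<in> carrier G \<Longrightarrow> g \<in> carrier G \<Longrightarrow>
     conjugate (x \<otimes> y) g = conjugate x (conjugate y g)"
  by (simp add: conjugate_def m_assoc inv_mult_group)

lemma conjugate_inv [simp]:
  "x \<in> carrier G \<Longrightarrow> g \<in> carrier G \<Longrightarrow> conjugate (inv x) (conjugate x g) = g"
  "x \<in> carrier G \<Longrightarrow> g \<in> carrier G \<Longrightarrow> conjugate x (conjugate (inv x) g) = g"
  by (simp_all add: conjugate_def m_assoc)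

definition prod_list :: "'a list \<Rightarrow> 'a" where
  "prod_list xs = foldr (\<otimes>) xs \<one>"

lemma prod_list_simps [simp]: "prod_list [] = \<one>" "prod_list (x # xs) = x \<otimes> prod_list xs"
  by (simp_all add: prod_list_def)

lemma prod_list_closed [simp]: "set xs \<subseteq> carrier G \<Longrightarrow> prod_list xs \<in> carrier G"
  by (induction xs) auto

lemma prod_list_append [simp]:
  "set xs \<subseteq> carrier G \<Longrightarrow> set ys \<subseteq> carrier G \<Longrightarrow>
     prod_list (xs @ ys) = prod_list xs \<otimes> prod_list ys"
  by (induction xs) (auto simp: m_assoc)

text \<open>
  The equivalence relation generated by the Hurwitz moves inside a longer tuple.  In contrast to
  the orbit relation, it does not mention the length of the tuple, so that equivalences of
  subtuples can be put together.
\<close>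

inductive hurwitz :: "'a list \<Rightarrow> 'a list \<Rightarrow> bool" (infix "\<sim>" 50) where
  move: "a \<in> carrier G \<Longrightarrow> b \<in> carrier G \<Longrightarrow> xs @ [a, b] @ ys \<sim> xs @ [conjugate a b, a] @ ys"
| refl [intro, simp]: "xs \<sim> xs"
| sym: "xs \<sim> ys \<Longrightarrow> ys \<sim> xs"
| trans [trans]: "xs \<sim> ys \<Longrightarrow> ys \<sim> zs \<Longrightarrow> xs \<sim> zs"

lemma hurwitz_context: "xs \<sim> ys \<Longrightarrow> as @ xs @ bs \<sim> as @ ys @ bs"
proof (induction rule: hurwitz.induct)
  case (move a b xs ys)
  then show ?case using hurwitz.move[of a b "as @ xs" "ys @ bs"] by simp
qed (auto intro: hurwitz.intros)

lemma hurwitz_append: "xs \<sim> xs' \<Longrightarrow> ys \<sim> ys' \<Longrightarrow> xs @ ys \<sim> xs' @ ys'"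
  using hurwitz_context[of xs xs' "[]" ys] hurwitz_context[of ys ys' xs' "[]"]
  by (auto intro: hurwitz.trans)

lemma hurwitz_Cons: "xs \<sim> ys \<Longrightarrow> a # xs \<sim> a # ys"
  using hurwitz_context[of xs ys "[a]" "[]"] by simp

lemma hurwitz_pair:
  assumes "a \<in> carrier G" "b \<in> carrier G"
  shows "[a, b] \<sim> [conjugate a b, a]" "[a, b] \<sim> [b, conjugate (inv b) a]"
  using hurwitz.move[of a b "[]" "[]"] hurwitz.move[of b "conjugate (inv b) a" "[]" "[]"] assms
  by (auto intro: hurwitz.sym)

lemma hurwitz_length: "xs \<sim> ys \<Longrightarrow> length xs = length ys"
  by (induction rule: hurwitz.induct) auto

lemma hurwitz_carrier: "xs \<sim> ys \<Longrightarrow> set xs \<subseteq> carrier G \<longleftrightarrow> set ys \<subseteq> carrier G"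
  by (induction rule: hurwitz.induct) auto

lemma hurwitz_prod: "xs \<sim> ys \<Longrightarrow> set xs \<subseteq> carrier G \<Longrightarrow> prod_list xs = prod_list ys"
proof (induction rule: hurwitz.induct)
  case (move a b xs ys)
  then show ?case by (simp add: conjugate_def m_assoc)
qed (use hurwitz_carrier in auto)

lemma hurwitz_conjugate_closed:
  assumes "xs \<sim> ys"
    and S: "\<And>x g. x \<in> carrier G \<Longrightarrow> g \<in> carrier G \<Longrightarrow> conjugate x g \<in> S \<longleftrightarrow> g \<in> S"
  shows "set xs \<subseteq> S \<longleftrightarrow> set ys \<subseteq> S"
  using assms(1) by (induction rule: hurwitz.induct) (auto simp: S)

lemma hurwitz_equivalent_if_hurwitz:
  assumes "xs \<sim> ys" "set xs \<subseteq> carrier G"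
  shows "hurwitz_equivalent G xs ys"
proof -
  define k where "k = length xs"
  interpret act: group_action "braid_group k" "tuples G k" "hurwitz_action G k"
    by (rule group_action_hurwitz)
  have "ys \<in> tuples G k \<and> ys \<in> orbit (braid_group k) (hurwitz_action G k) xs"
    if "xs \<in> tuples G k" using assms(1) that
  proof (induction rule: hurwitz.induct)
    case (move a b xs ys)
    let ?i = "Suc (length xs)"
    have i: "?i \<in> {1..<k}" using move by (auto simp: tuples_def)
    have mem: "\<sigma> k ?i \<in> carrier (braid_group k)"
      using i by (auto simp: braid_group_def braid_of_def carrier_presented_group)
    have eq: "hurwitz_action G k (\<sigma> k ?i) (xs @ [a, b] @ ys) = xs @ [conjugate a b, a] @ ys"
      using move i
      by (simp add: hurwitz_action_generator hurwitz_move_def conjugate_def nth_append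
          list_update_append)
    then show ?case
      using mem move(3) act.element_image[OF mem move(3) eq] unfolding orbit_def by force
  next
    case (refl xs)
    then show ?case using act.orbit_refl by blast
  next
    case (sym xs ys)
    have "xs \<in> tuples G k"
      using sym hurwitz_length[OF sym(1)] hurwitz_carrier[OF sym(1)] by (auto simp: tuples_def)
    then show ?case using sym act.orbit_sym by blast
  next
    case (trans xs ys zs)
    then show ?case using act.orbit_trans by blast
  qed
  then show ?thesis
    using assms(2) unfolding hurwitz_equivalent_def by (auto simp: tuples_def k_def)
qed

end

section \<open>Groups generated by three atoms, acting on the tree\<close>

text \<open>
  The part of the dual Garside structure of the braid group on three strings that the argument
  uses: the relations between the three atoms provide Hurwitz moves, and the action on the tree
  provides lengths and distinguishes reduced words.
\<close>

locale atom_group = group G for G (structure) +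
  fixes t :: "atom \<Rightarrow> 'a" and act :: "'a \<Rightarrow> atom list \<Rightarrow> atom list"
  assumes action: "group_action G {w. reduced w} act"
    and t_closed [simp, intro]: "t i \<in> carrier G"
    and generated: "carrier G = generate G (range t)"
    and t_mult: "t i \<otimes> t (nxt i) = t A \<otimes> t B"
    and act_t [simp]: "reduced w \<Longrightarrow> act (t i) w = push i w"
begin

sublocale act: group_action G "{w. reduced w}" act
  by (rule action)

definition \<delta> :: 'a where
  "\<delta> = t A \<otimes> t B"

lemma \<delta>_closed [simp, intro]: "\<delta> \<in> carrier G"
  by (simp add: \<delta>_def)

lemma t_t_nxt: "t i \<otimes> t (nxt i) = \<delta>"
  by (simp add: \<delta>_def t_mult)

lemma \<delta>_t: "\<delta> \<otimes> t i = t (nxt i) \<otimes> \<delta>"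
  using t_t_nxt[of "nxt i"] t_t_nxt[of "prv i"] by (metis m_assoc nxt_cycle t_closed)

lemma conjugate_one [simp]: "g \<in> carrier G \<Longrightarrow> conjugate \<one> g = g"
  by (simp add: conjugate_def)

lemma conjugate_\<delta>_t [simp]: "conjugate \<delta> (t i) = t (nxt i)"
  by (simp add: conjugate_def \<delta>_t m_assoc)

lemma act_closed [simp]: "x \<in> carrier G \<Longrightarrow> reduced w \<Longrightarrow> reduced (act x w)"
  using act.element_image by blast

lemma act_mult [simp]:
  "x \<in> carrier G \<Longrightarrow> y \<in> carrier G \<Longrightarrow> reduced w \<Longrightarrow> act (x \<otimes> y) w = act x (act y w)"
  by (intro act.composition_rule) auto

lemma act_one [simp]: "reduced w \<Longrightarrow> act \<one> w = w"
  using act.id_eq_one by (metis mem_Collect_eq restrict_apply')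

lemma act_inv_eq: "x \<in> carrier G \<Longrightarrow> reduced v \<Longrightarrow> act x v = w \<Longrightarrow> act (inv x) w = v"
  by (intro act.orbit_sym_aux) auto

lemma act_inv [simp]:
  assumes "x \<in> carrier G" "reduced v"
  shows "act (inv x) (act x v) = v" "act x (act (inv x) v) = v"
  using assms act_inv_eq[of x v] act_inv_eq[of "inv x" v] by auto

lemma act_\<delta> [simp]: "reduced w \<Longrightarrow> act \<delta> w = map nxt w"
  using push_push_nxt[of w A] by (simp add: \<delta>_def)

lemma act_isometry:
  assumes "x \<in> carrier G" "reduced u" "reduced v"
  shows "tree_dist (act x u) (act x v) = tree_dist u v"
proof -
  have "x \<in> generate G (range t)" using assms generated by simp
  then have "reduced u \<longrightarrow> reduced v \<longrightarrow> tree_dist (act x u) (act x v) = tree_dist u v" for u v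
  proof (induction arbitrary: u v rule: generate.induct)
    case (incl h)
    then show ?case by (auto simp: tree_dist_push)
  next
    case (inv h)
    then obtain i where h: "h = t i" by blast
    have "tree_dist (push i (act (inv h) u)) (push i (act (inv h) v)) =
        tree_dist (act (inv h) u) (act (inv h) v)"
      if "reduced u" "reduced v" using that by (intro tree_dist_push) (auto simp: h)
    moreover have "push i (act (inv h) w) = w" if "reduced w" for w
      using that act_inv(2)[of h w] by (simp add: h del: act_inv)
    ultimately show ?case by auto
  next
    case (eng x y)
    then show ?case by (simp add: generated[symmetric])
  qed simp
  with assms show ?thesis by simp
qed

text \<open>
  The distance by which \<open>x\<close> moves the root.
\<close>

definition len :: "'a \<Rightarrow> nat" where
  "len x = length (act x [])"

lemma len_inv_mult:
  assumes "x \<in> carrier G" "y \<in> carrier G"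
  shows "len (inv x \<otimes> y) = tree_dist (act x []) (act y [])"
  using assms act_isometry[of x "[]" "act (inv x) (act y [])"] by (simp add: len_def)

lemma len_one [simp]: "len \<one> = 0"
  by (simp add: len_def)

lemma len_inv [simp]: "x \<in> carrier G \<Longrightarrow> len (inv x) = len x"
  using len_inv_mult[of x \<one>] by (simp add: len_def tree_dist_def)

text \<open>
  The four-point condition for the images of the root under \<open>\<one>\<close>, \<open>x\<close>, \<open>y\<close>, \<open>z\<close>: in a tree, the
  larger two of the three sums of distances of opposite pairs are equal.
\<close>

lemma len_four_point:
  assumes "x \<in> carrier G" "y \<in> carrier G" "z \<in> carrier G"
  shows "len x + len (inv y \<otimes> z) \<le> max (len y + len (inv x \<otimes> z)) (len z + len (inv x \<otimes> y))"
proof -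
  let ?m = "\<lambda>x y. length (longest_common_prefix (act x []) (act y []))"
  have comm: "?m x y = ?m y x" by (simp only: lcp_commute)
  have "len (inv x \<otimes> y) + 2 * ?m x y = len x + len y" if "x \<in> carrier G" "y \<in> carrier G" for x y
    using that tree_dist_eq[of "act x []" "act y []"] by (simp only: len_inv_mult) (simp add: len_def)
  from this[OF assms(1,2)] this[OF assms(1,3)] this[OF assms(2,3)]
  show ?thesis
    using lcp_ultrametric[of "act y []" "act x []" "act z []"] comm by linarith
qed

lemma conjugate_\<delta>_len [simp]: "g \<in> carrier G \<Longrightarrow> len (conjugate \<delta> g) = len g"
  using act_inv_eq[of \<delta> "[]" "[]"] by (simp add: len_def conjugate_def)

lemma conjugate_inv_\<delta>_len [simp]: "g \<in> carrier G \<Longrightarrow> len (conjugate (inv \<delta>) g) = len g"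
  using conjugate_\<delta>_len[of "conjugate (inv \<delta>) g"] by simp

definition word :: "atom list \<Rightarrow> 'a" where
  "word w = prod_list (map t w)"

lemma word_simps [simp]: "word [] = \<one>" "word (i # w) = t i \<otimes> word w"
  by (simp_all add: word_def)

lemma word_closed [simp, intro]: "word w \<in> carrier G"
  by (induction w) auto

lemma word_append: "word (v @ w) = word v \<otimes> word w"
  by (induction v) (auto simp: m_assoc)

lemma len_word_le: "len (word w) \<le> length w"
proof (induction w)
  case (Cons i w)
  then show ?case using length_push_le[of i "act (word w) []"] by (simp add: len_def)
qed simp

lemma \<delta>_word: "\<delta> \<otimes> word w = word (map nxt w) \<otimes> \<delta>"
proof (induction w)
  case (Cons i w)
  have "\<delta> \<otimes> (t i \<otimes> word w) = t (nxt i) \<otimes> (\<delta> \<otimes> word w)"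
    by (simp add: m_assoc[symmetric] \<delta>_t)
  with Cons show ?case by (simp add: m_assoc)
qed simp

lemma conjugate_\<delta>_word:
  "g \<in> carrier G \<Longrightarrow>
     conjugate \<delta> (conjugate (word w) g) = conjugate (word (map nxt w)) (conjugate \<delta> g)"
  by (simp add: conjugate_mult[symmetric] \<delta>_word)

lemma act_word: "reduced (w @ v) \<Longrightarrow> act (word w) v = w @ v"
proof (induction w)
  case (Cons i w)
  then have "reduced v" "reduced (w @ v)" "push i (w @ v) = i # w @ v"
    by (auto simp: reduced_Cons reduced_append push_def)
  with Cons show ?case by simp
qed simp

text \<open>
  Seen from the vertex \<open>w @ [l]\<close>, the root lies at the same distance as the vertex from the root, and
  the first edge of the way back only depends on \<open>l\<close>.
\<close>

lemma act_inv_word: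
  assumes "reduced (w @ [l])"
  shows "\<exists>z. act (inv (word (w @ [l]))) [] = nxt l # z \<and> length z = length w \<and> reduced (nxt l # z)"
  using assms
proof (induction w arbitrary: l rule: rev_induct)
  case Nil
  then show ?case using act_inv_eq[of "t l" "[nxt l]" "[]"] by simp
next
  case (snoc k w)
  then obtain z where z: "act (inv (word (w @ [k]))) [] = nxt k # z" "length z = length w"
    "reduced (nxt k # z)"
    by (auto simp: reduced_append)
  have l: "l \<noteq> nxt k" using snoc.prems by (auto simp: reduced_append)
  let ?z = "k # map nxt (map nxt z)"
  have "map nxt (map nxt (nxt k # z)) = ?z" by simp
  with z have "reduced ?z" by (metis reduced_simps(4))
  then have red: "reduced (nxt l # ?z)" using l by auto
  have "act (inv (t l)) (nxt k # z) = nxt l # ?z"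
    using red by (intro act_inv_eq) (auto simp: comp_def)
  moreover have "word ((w @ [k]) @ [l]) = word (w @ [k]) \<otimes> t l"
    by (simp only: word_append[of "w @ [k]"]) simp
  ultimately have "act (inv (word ((w @ [k]) @ [l]))) [] = nxt l # ?z"
    using z by (simp add: inv_mult_group del: append_assoc)
  then show ?case using z(2) red by auto
qed

section \<open>Conjugates of an atom\<close>

text \<open>
  The name recalls the isomorphism of the braid group on three strings with the mapping class
  group of the torus with one hole, under which the conjugates of \<open>\<sigma>\<^sub>1\<close> are the positive Dehn twists along
  non-separating curves.
\<close>

definition twists :: "'a set" where
  "twists = {conjugate x (t A) | x. x \<in> carrier G}"

text \<open>
  In the case \<open>long\<close>, the conjugated atom is determined by the last letter: since \<open>t l\<close> commutes
  with itself, and \<open>t l \<otimes> t (nxt l) \<otimes> inv (t l) = t (prv l)\<close> is again an atom, \<open>t (prv l)\<close> is the only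
  atom that becomes longer when it is conjugated by \<open>t l\<close>.
\<close>

inductive_set standard_twists :: "'a set" where
  atom: "t i \<in> standard_twists"
| long: "reduced (w @ [l]) \<Longrightarrow> conjugate (word (w @ [l])) (t (prv l)) \<in> standard_twists"

lemma standard_closed: "g \<in> standard_twists \<Longrightarrow> g \<in> carrier G"
  by (induction rule: standard_twists.induct) auto

text \<open>
  The set of standard conjugates contains the atoms and is closed under conjugation by the atoms,
  by \<open>\<delta>\<close>, and by their inverses; hence it contains all conjugates of an atom.
\<close>

lemma standard_conjugate_\<delta>: "g \<in> standard_twists \<Longrightarrow> conjugate \<delta> g \<in> standard_twists"
proof (induction rule: standard_twists.induct)
  case (long w l)
  then have "reduced (map nxt w @ [nxt l])" using reduced_simps(4)[of "w @ [l]"] by simp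
  then show ?case using standard_twists.long[of "map nxt w" "nxt l"] by (simp add: conjugate_\<delta>_word)
qed (auto intro: standard_twists.intros)

lemma conjugate_t_prv:
  "g \<in> carrier G \<Longrightarrow>
     conjugate (t (prv i)) (conjugate (word (i # w)) g) = conjugate (word (map nxt w)) (conjugate \<delta> g)"
  using t_t_nxt[of "prv i"]
  by (simp add: conjugate_mult[symmetric] m_assoc[symmetric] \<delta>_word)

lemma conjugate_t_t_nxt: "conjugate (t i) (t (nxt i)) = t (prv i)"
proof -
  have "conjugate (t i) (t (nxt i)) = (t (prv i) \<otimes> t i) \<otimes> inv (t i)"
    using t_t_nxt[of "prv i"] by (simp add: conjugate_def t_t_nxt)
  then show ?thesis by (simp add: m_assoc)
qed

lemma standard_conjugate_t: "g \<in> standard_twists \<Longrightarrow> conjugate (t i) g \<in> standard_twists"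
proof (induction rule: standard_twists.induct)
  case (atom j)
  consider "j = i" | "j = nxt i" | "j = prv i" by (cases i; cases j) auto
  then show ?case
  proof cases
    case 1
    then have "conjugate (t i) (t j) = t i" by (simp add: conjugate_def m_assoc)
    then show ?thesis by (simp add: standard_twists.atom)
  next
    case 2
    then show ?thesis by (simp add: conjugate_t_t_nxt standard_twists.atom)
  next
    case 3
    then show ?thesis using standard_twists.long[of "[]" i] by simp
  qed
next
  case (long w l)
  show ?case
  proof (cases "hd (w @ [l]) = nxt i")
    case False
    then have "reduced ((i # w) @ [l])"
      using long by (cases w) auto
    then show ?thesis
      using standard_twists.long[of "i # w" l] by (simp add: conjugate_mult)
  next
    case True
    have step: "conjugate (t i) (conjugate (word (nxt i # v)) g) = conjugate (word (map nxt v)) (conjugate \<delta> g)"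
      if "g \<in> carrier G" for g v
      using conjugate_t_prv[OF that, of "nxt i" v] by simp
    show ?thesis
    proof (cases w)
      case Nil
      then show ?thesis using True step[of "t (prv l)" "[]"] standard_twists.atom[of l] by auto
    next
      case (Cons j v)
      then have "reduced (v @ [l])" using long by (auto simp: reduced_Cons)
      then have "reduced (map nxt v @ [nxt l])" using reduced_simps(4)[of "v @ [l]"] by simp
      then show ?thesis
        using Cons True step[of "t (prv l)" "v @ [l]"] standard_twists.long[of "map nxt v" "nxt l"] by simp
    qed
  qed
qed

lemma standard_conjugate_inv_\<delta>: assumes "g \<in> standard_twists" shows "conjugate (inv \<delta>) g \<in> standard_twists"
proof -
  have "\<exists>h\<in>standard_twists. conjugate \<delta> h = g" using assms
  proof (induction rule: standard_twists.induct)
    case (atom i)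
    then show ?case using standard_twists.atom[of "prv i"] by (intro bexI[of _ "t (prv i)"]) auto
  next
    case (long w l)
    let ?p = "\<lambda>w. map nxt (map nxt w)"
    have "reduced (?p w @ [prv l])" using long reduced_simps(4) by (metis list.map map_append)
    then have "conjugate (word (?p w @ [prv l])) (t (prv (prv l))) \<in> standard_twists" by (rule standard_twists.long)
    moreover have "conjugate \<delta> (conjugate (word (?p w @ [prv l])) (t (prv (prv l)))) = conjugate (word (w @ [l])) (t (prv l))"
      by (subst conjugate_\<delta>_word) (auto simp: comp_def)
    ultimately show ?case by blast
  qed
  then obtain h where "h \<in> standard_twists" "conjugate \<delta> h = g" by blast
  then show ?thesis using standard_closed by auto
qed

lemma inv_t: "inv (t i) = t (nxt i) \<otimes> inv \<delta>"
  using t_t_nxt[of i] by (intro inv_equality[OF _ _]) (auto simp: t_t_nxt[symmetric, of i] inv_mult_group m_assoc)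

lemma twists_subset_standard: "twists \<subseteq> standard_twists"
proof
  fix g assume "g \<in> twists"
  then obtain x where x: "x \<in> carrier G" "g = conjugate x (t A)" by (auto simp: twists_def)
  then have "x \<in> generate G (range t)" using generated by simp
  then have "conjugate x h \<in> standard_twists" if "h \<in> standard_twists" for h using that
  proof (induction arbitrary: h rule: generate.induct)
    case one
    then show ?case using standard_closed by (auto simp: conjugate_def)
  next
    case (incl h')
    then show ?case using standard_conjugate_t by auto
  next
    case (inv y)
    then obtain i where "y = t i" by blast
    moreover have "conjugate (t (nxt i) \<otimes> inv \<delta>) h = conjugate (t (nxt i)) (conjugate (inv \<delta>) h)"
      using standard_closed[OF inv(2)] by (intro conjugate_mult) auto
    ultimately show ?case using standard_conjugate_t standard_conjugate_inv_\<delta> inv by (simp add: inv_t)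
  next
    case (eng x y)
    then show ?case using standard_closed by (simp add: conjugate_mult generated[symmetric])
  qed
  then show "g \<in> standard_twists" using x standard_twists.atom by blast
qed

lemma twists_closed: "g \<in> twists \<Longrightarrow> g \<in> carrier G"
  by (auto simp: twists_def)

lemma twists_conjugate_iff: "x \<in> carrier G \<Longrightarrow> g \<in> carrier G \<Longrightarrow> conjugate x g \<in> twists \<longleftrightarrow> g \<in> twists"
proof
  assume x: "x \<in> carrier G" "g \<in> carrier G" "conjugate x g \<in> twists"
  then obtain y where y: "y \<in> carrier G" "conjugate x g = conjugate y (t A)" by (auto simp: twists_def)
  then have "g = conjugate (inv x \<otimes> y) (t A)"
    using x by (metis conjugate_inv(1) conjugate_mult inv_closed t_closed)
  then show "g \<in> twists" using x y by (auto simp: twists_def)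
next
  assume x: "x \<in> carrier G" "g \<in> twists"
  then obtain y where "y \<in> carrier G" "g = conjugate y (t A)" by (auto simp: twists_def)
  then have "conjugate x g = conjugate (x \<otimes> y) (t A)" using x by (simp add: conjugate_mult)
  then show "conjugate x g \<in> twists" using x \<open>y \<in> carrier G\<close> by (auto simp: twists_def)
qed

lemma twist_cases:
  assumes "g \<in> twists"
  obtains i where "g = t i" | w l where "g = conjugate (word (w @ [l])) (t (prv l))" "reduced (w @ [l])"
proof -
  have "g \<in> standard_twists" using assms twists_subset_standard by blast
  then show thesis by (cases rule: standard_twists.cases) (use that in blast)+
qed

text \<open>
  A conjugate of an atom translates along an axis by one edge.  For \<open>g\<close> as below, the axis is at
  distance \<open>length w + 1\<close> from the root, and the nearest vertex is \<open>w @ [l]\<close>.  At this vertex two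
  edges lead away from the root; both belong to the axis, and the ways to the images of the root
  under \<open>g\<close> and \<open>inv g\<close> take one each.
\<close>

lemma long_act:
  assumes "reduced (w @ [l])"
  defines "g \<equiv> conjugate (word (w @ [l])) (t (prv l))"
  shows "\<exists>z. length z = length w + 1 \<and> act g [] = w @ [l, prv l] @ z \<and>
    act (g \<otimes> g) [] = w @ [l, prv l, prv l] @ z"
    and "\<exists>z. length z = length w + 1 \<and> act (inv g) [] = w @ [l, l] @ z"
proof -
  obtain z where z: "act (inv (word (w @ [l]))) [] = nxt l # z" "length z = length w"
    "reduced (nxt l # z)"
    using act_inv_word[OF assms(1)] by blast
  let ?W = "word (w @ [l])"
  have r: "reduced (w @ [l, prv l] @ nxt l # z)" "reduced (w @ [l, prv l, prv l] @ nxt l # z)"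
    using assms(1) z(3) by (auto simp: reduced_append)
  have gg: "g \<otimes> g = conjugate ?W (t (prv l) \<otimes> t (prv l))"
    by (simp add: g_def conjugate_def m_assoc)
  have "act g [] = w @ [l, prv l] @ nxt l # z"
    using z r(1) act_word[of "w @ [l]" "prv l # nxt l # z"] by (simp add: g_def conjugate_def)
  moreover have "act (g \<otimes> g) [] = w @ [l, prv l, prv l] @ nxt l # z"
    using z r(2) act_word[of "w @ [l]" "prv l # prv l # nxt l # z"] unfolding gg
    by (simp add: conjugate_def)
  ultimately show "\<exists>z. length z = length w + 1 \<and> act g [] = w @ [l, prv l] @ z \<and>
    act (g \<otimes> g) [] = w @ [l, prv l, prv l] @ z" using z(2) by (intro exI[of _ "nxt l # z"]) auto
  let ?z = "map nxt (map nxt z)"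
  have "map nxt (map nxt (nxt l # z)) = l # ?z" by simp
  with z have "reduced (l # ?z)" by (metis reduced_simps(4))
  then have r: "reduced (w @ [l, l] @ l # ?z)" "reduced (l # l # ?z)"
    using assms(1) by (auto simp: reduced_append)
  have "act (inv (t (prv l))) (nxt l # z) = l # l # ?z"
    using r(2) by (intro act_inv_eq) (auto simp: push_def comp_def)
  moreover have "inv g = conjugate ?W (inv (t (prv l)))"
    by (simp add: g_def conjugate_def m_assoc inv_mult_group)
  ultimately have "act (inv g) [] = w @ [l, l] @ l # ?z"
    using z r act_word[of "w @ [l]" "l # l # ?z"] by (simp add: conjugate_def)
  then show "\<exists>z. length z = length w + 1 \<and> act (inv g) [] = w @ [l, l] @ z"
    using z(2) by (intro exI[of _ "l # ?z"]) auto
qed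

lemma len_long:
  assumes "reduced (w @ [l])"
  shows "len (conjugate (word (w @ [l])) (t (prv l))) = 2 * length w + 3"
  using long_act(1)[OF assms] by (auto simp: len_def)

lemma len_t [simp]: "len (t i) = 1"
  by (simp add: len_def)

lemma len_twist: assumes "g \<in> twists" shows "odd (len g)" "len (g \<otimes> g) = len g + 1"
proof -
  have "odd (len g) \<and> len (g \<otimes> g) = len g + 1"
    using assms
  proof (cases rule: twist_cases)
    case (1 i)
    then show ?thesis by (auto simp: len_def push_def)
  next
    case (2 w l)
    then show ?thesis using long_act(1)[OF 2(2)] by (auto simp: len_def)
  qed
  then show "odd (len g)" "len (g \<otimes> g) = len g + 1" by auto
qed

text \<open>
  If the way to the axis of \<open>g\<close> begins with the edge \<open>i\<close>, then conjugation by
  \<open>t (prv i)\<close> merges \<open>t (prv i)\<close> and \<open>t i\<close> into \<open>\<delta>\<close>, which does not change the length.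
\<close>

lemma shorten:
  assumes "g \<in> twists" "g \<notin> range t"
  shows "\<exists>i. len (conjugate (t i) g) < len g"
  using assms(1)
proof (cases rule: twist_cases)
  case (2 w l)
  note g = 2
  show ?thesis
  proof (cases w)
    case Nil
    have "conjugate (t (prv l)) g = conjugate \<delta> (t (prv l))"
      using conjugate_t_prv[of "t (prv l)" l "[]"] by (simp add: g Nil)
    then show ?thesis using len_long[OF g(2)] g Nil by (intro exI[of _ "prv l"]) simp
  next
    case (Cons i v)
    have "reduced (v @ [l])" using g Cons by (auto simp: reduced_Cons)
    then have "len (conjugate \<delta> (conjugate (word (v @ [l])) (t (prv l)))) < len g"
      using len_long[of v l] len_long[OF g(2)] g Cons by simp
    moreover have "conjugate (t (prv i)) g = conjugate \<delta> (conjugate (word (v @ [l])) (t (prv l)))"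
      using conjugate_t_prv[of "t (prv l)" i "v @ [l]"]  conjugate_\<delta>_word[of "t (prv l)" "v @ [l]"]
      by (simp add: g Cons)
    ultimately show ?thesis by (intro exI[of _ "prv i"]) simp
  qed
qed (use assms in auto)

section \<open>Products of two conjugates\<close>

text \<open>
  For conjugates of an atom: \<open>h\<close> moves the root less than \<open>g\<close> does, and the cancellation in
  \<open>g \<otimes> h\<close> shows that the axis of \<open>g\<close> lies beyond the axis of \<open>h\<close> in the direction of the translation \<open>h\<close>; translating
  backwards by \<open>h\<close> brings it closer to the root.  In the proof, the four-point condition
  replaces the axes: it is applied first to \<open>inv g\<close>, \<open>g\<close>, \<open>h\<close> and then to \<open>g\<close>, \<open>h\<close>, \<open>g \<otimes> h\<close>.
\<close>

lemma len_conjugate_less: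
  assumes g: "g \<in> carrier G" "len (g \<otimes> g) = len g + 1" and h: "h \<in> carrier G"
    and gh: "len (g \<otimes> h) < len g" "len h + 1 < len g"
  shows "len (conjugate (inv h) g) < len g"
proof -
  have "len (inv g) + len (inv g \<otimes> h)
      \<le> max (len g + len (inv (inv g) \<otimes> h)) (len h + len (inv (inv g) \<otimes> g))"
    using g h by (intro len_four_point) auto
  then have "len (inv g \<otimes> h) < len g" using g h gh by simp
  moreover have "len g + len (inv h \<otimes> (g \<otimes> h))
      \<le> max (len h + len (inv g \<otimes> (g \<otimes> h))) (len (g \<otimes> h) + len (inv g \<otimes> h))"
    using g h by (intro len_four_point) auto
  ultimately show ?thesis using g h gh by (simp add: conjugate_def m_assoc)
qed

lemma even_len_twist_mult:
  assumes "g \<in> twists" "h \<in> twists"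
  shows "even (len (g \<otimes> h))"
proof -
  have "len (g \<otimes> h) + 2 * length (longest_common_prefix (act (inv g) []) (act h [])) = len g + len h"
    using tree_dist_eq[of "act (inv g) []" "act h []"] len_inv_mult[of "inv g" h] assms
      len_inv[of g] twists_closed
    by (simp add: len_def)
  then show ?thesis using len_twist(1) assms by (metis dvd_triv_left even_add)
qed

lemma twist_len_1: "g \<in> twists \<Longrightarrow> len g = 1 \<Longrightarrow> g \<in> range t"
  by (erule twist_cases) (auto simp: len_long)

text \<open>
  Unless \<open>g\<close> and \<open>h\<close> are two atoms with product \<open>\<delta>\<close>, a Hurwitz move shortens a pair with too much
  cancellation.  If the lengths differ, this is \<open>len_conjugate_less\<close>.  If they are equal and
  greater than 1, so much cancellation is impossible: it would mean that the ways to the images of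
  the root under \<open>inv g\<close> and \<open>h\<close> agree up to and including the first edge on the axes.  Then both axes
  are reached at the same vertex, which makes \<open>g = h\<close>, but \<open>inv g\<close> and \<open>g\<close> leave this vertex by
  different edges.
\<close>

lemma short_product:
  assumes g: "g \<in> twists" and h: "h \<in> twists" and short: "len (g \<otimes> h) < max (len g) (len h)"
  shows "(\<exists>i. g = t i \<and> h = t (nxt i)) \<or> len (conjugate g h) < len h \<or> len (conjugate (inv h) g) < len g"
proof -
  note closed = twists_closed[OF g] twists_closed[OF h]
  consider "len g = len h" | "len h + 1 < len g" | "len g + 1 < len h"
  proof -
    have "len g = len h \<or> len h + 1 < len g \<or> len g + 1 < len h"
      using len_twist(1)[OF g] len_twist(1)[OF h] by (auto elim!: oddE)
    then show thesis using that by blast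
  qed
  then show ?thesis
  proof cases
    case 1
    from g show ?thesis
    proof (cases rule: twist_cases)
      case (1 i)
      then obtain j where j: "h = t j" using twist_len_1[OF h] \<open>len g = len h\<close> by auto
      have "len (g \<otimes> h) = length (push i [j])" by (simp add: len_def 1 j)
      then show ?thesis using short 1 j by (auto simp: push_def split: if_splits)
    next
      case (2 w l)
      then have lg: "len g = 2 * length w + 3" by (simp add: len_long)
      from h show ?thesis
      proof (cases rule: twist_cases)
        case (1 i)
        then show ?thesis using lg \<open>len g = len h\<close> by simp
      next
        case (2 w' l')
        then have lw: "length w' = length w" using lg \<open>len g = len h\<close> by (simp add: len_long)
        have "len (g \<otimes> h) + 2 * length (longest_common_prefix (act (inv g) []) (act h [])) = len g + len h"
          using tree_dist_eq[of "act (inv g) []" "act h []"] len_inv_mult[of "inv g" h] closed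
            len_inv[of g] by (simp add: len_def)
        then have "length w + 2 \<le> length (longest_common_prefix (act (inv g) []) (act h []))"
          using short lg \<open>len g = len h\<close> by simp
        then have "take (length w + 2) (act (inv g) []) = take (length w + 2) (act h [])"
          by (rule lcp_take)
        moreover obtain y where "act (inv g) [] = w @ [l, l] @ y"
          using long_act(2)[of w l] \<open>reduced (w @ [l])\<close> \<open>g = _\<close> by blast
        moreover obtain z where "act h [] = w' @ [l', prv l'] @ z"
          using long_act(1)[of w' l'] 2 by blast
        ultimately show ?thesis using lw by auto
      qed
    qed
  next
    case 2
    then show ?thesis using len_conjugate_less[of g h] closed len_twist[OF g] short by simp
  next
    case 3
    have "len (conjugate (inv (inv g)) (inv h)) < len (inv h)"
    proof (intro len_conjugate_less)
      show "len (inv h \<otimes> inv h) = len (inv h) + 1"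
        using len_twist(2)[OF h] len_inv[of "h \<otimes> h"] closed by (simp add: inv_mult_group)
      show "len (inv h \<otimes> inv g) < len (inv h)"
        using short 3 len_inv[of "g \<otimes> h"] closed by (simp add: inv_mult_group)
    qed (use 3 closed in auto)
    moreover have "conjugate (inv (inv g)) (inv h) = inv (conjugate g h)"
      using closed by (simp add: conjugate_def inv_mult_group m_assoc)
    ultimately show ?thesis using closed len_inv[of "conjugate g h"] by simp
  qed
qed

section \<open>Products without cancellation\<close>

text \<open>
  If neighbours cancel less than half of each other, the middle edge of every factor survives in
  the path from the root to its image under the product.  So each further factor \<open>h\<close> after \<open>g\<close> changes
  the length of the partial product by the same amount \<open>len (g \<otimes> h) - len g\<close> as it changes the length
  of \<open>g\<close> alone.  This is at least 1, and it is at least \<open>len h - len g + 1\<close>.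
\<close>

lemma len_prod_chain:
  assumes "set (xs @ [g]) \<subseteq> twists"
    "successively (\<lambda>g h. max (len g) (len h) < len (g \<otimes> h)) (xs @ [g])"
  shows "len (prod_list xs) < len (prod_list (xs @ [g]))"
    and "\<forall>a\<in>set (xs @ [g]). len a + length xs \<le> len (prod_list (xs @ [g]))"
proof -
  have "len (prod_list xs) < len (prod_list (xs @ [g])) \<and>
    (\<forall>a\<in>set (xs @ [g]). len a + length xs \<le> len (prod_list (xs @ [g])))"
    using assms
  proof (induction xs arbitrary: g rule: rev_induct)
    case Nil
    then show ?case using twists_closed len_twist(1)[of g] by (auto intro!: Nat.gr0I)
  next
    case (snoc f xs)
    let ?P = "prod_list (xs @ [f])"
    have sub: "set xs \<subseteq> carrier G" "f \<in> carrier G" "g \<in> carrier G"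
      using snoc.prems twists_closed by auto
    then have Pc: "?P \<in> carrier G" by simp
    have fg: "max (len f) (len g) < len (f \<otimes> g)"
      using snoc.prems by (simp add: successively_append_iff)
    have IH: "len (prod_list xs) < len ?P" "\<And>a. a \<in> set (xs @ [f]) \<Longrightarrow> len a + length xs \<le> len ?P"
      using snoc.IH[of f] snoc.prems by (auto simp: successively_append_iff)
    \<comment> \<open>By \<open>fg\<close> and \<open>IH\<close>, the second term of the maximum is smaller than the left-hand side.\<close>
    have "len (inv ?P) + len (inv (inv f) \<otimes> g)
        \<le> max (len (inv f) + len (inv (inv ?P) \<otimes> g)) (len g + len (inv (inv ?P) \<otimes> inv f))"
      using sub Pc by (intro len_four_point) auto
    moreover have "?P \<otimes> inv f = prod_list xs" using sub by (simp add: m_assoc)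
    ultimately have "len ?P + len (f \<otimes> g) \<le> len f + len (?P \<otimes> g)"
      using sub Pc IH(1) fg by simp linarith
    moreover have "prod_list ((xs @ [f]) @ [g]) = ?P \<otimes> g"
      using sub by (simp add: m_assoc)
    ultimately show ?case using IH(2) fg by fastforce
  qed
  then show "len (prod_list xs) < len (prod_list (xs @ [g]))"
    and "\<forall>a\<in>set (xs @ [g]). len a + length xs \<le> len (prod_list (xs @ [g]))" by auto
qed

text \<open>
  Without large cancellation, a factor of length at least 3 makes the product longer than the
  number of factors.
\<close>

lemma chain_atoms:
  assumes "set xs \<subseteq> twists" "successively (\<lambda>g h. max (len g) (len h) < len (g \<otimes> h)) xs"
    "len (prod_list xs) \<le> length xs"
  shows "set xs \<subseteq> range t"
proof
  fix g assume g: "g \<in> set xs"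
  then obtain ys z where xs: "xs = ys @ [z]" by (metis empty_iff rev_exhaust set_empty)
  then have "len g + length ys \<le> length xs"
    using len_prod_chain(2)[of ys z] assms g by fastforce
  then have "len g \<le> 1" using xs by simp
  moreover have "odd (len g)" using g assms len_twist(1) by blast
  ultimately have "len g = 1" by (metis One_nat_def even_zero le_SucE le_zero_eq)
  then show "g \<in> range t" using twist_len_1 g assms by blast
qed

section \<open>Reduction to atoms\<close>

text \<open>
  The three pairs of atoms with product \<open>\<delta>\<close> are Hurwitz equivalent.  Such a pair can pass through any
  tuple, conjugating it by \<open>\<delta>\<close>, which preserves lengths.
\<close>

lemma atom_pair_turn: "[t i, t (nxt i)] \<sim> [t j, t (nxt j)]"
proof -
  have turn: "[t i, t (nxt i)] \<sim> [t (prv i), t i]" for i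
    using hurwitz_pair(1)[of "t i" "t (nxt i)"] by (simp add: conjugate_t_t_nxt)
  have turn2: "[t i, t (nxt i)] \<sim> [t (nxt i), t (prv i)]" for i
    using hurwitz.trans[OF turn[of i] turn[of "prv i", simplified]] by simp
  consider "j = i" | "j = nxt i" | "j = prv i" by (cases i; cases j) auto
  then show ?thesis using turn[of i] turn2[of i] by cases auto
qed

lemma slide_atom_pair:
  "set zs \<subseteq> carrier G \<Longrightarrow> [t i, t (nxt i)] @ zs \<sim> map (conjugate \<delta>) zs @ [t i, t (nxt i)]"
proof (induction zs)
  case (Cons z zs)
  let ?a = "t i" and ?b = "t (nxt i)"
  have z: "z \<in> carrier G" using Cons.prems by simp
  have "[?a] @ [?b, z] \<sim> [?a] @ [conjugate ?b z, ?b]"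
    using z by (intro hurwitz_append hurwitz_pair) auto
  also have "[?a] @ [conjugate ?b z, ?b] = [?a, conjugate ?b z] @ [?b]" by simp
  also have "[?a, conjugate ?b z] @ [?b] \<sim> [conjugate ?a (conjugate ?b z), ?a] @ [?b]"
    using z by (intro hurwitz_append hurwitz_pair) auto
  also have "conjugate ?a (conjugate ?b z) = conjugate \<delta> z"
    using z by (simp add: conjugate_mult[symmetric] t_t_nxt)
  finally have "[?a, ?b, z] @ zs \<sim> [conjugate \<delta> z, ?a, ?b] @ zs"
    by (intro hurwitz_append) auto
  also have "[conjugate \<delta> z, ?a, ?b] @ zs \<sim> [conjugate \<delta> z] @ map (conjugate \<delta>) zs @ [?a, ?b]"
    using Cons by (simp add: hurwitz_Cons)
  finally show ?case by simp
qed simp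

definition total_len :: "'a list \<Rightarrow> nat" where
  "total_len gs = sum_list (map len gs)"

text \<open>
  Since the second atom of the pair can be chosen freely, the pair is moved next to a factor \<open>g\<close> that
  is not an atom and turned so that its second atom is the one whose conjugation shortens \<open>g\<close>.
\<close>

lemma shorten_next_to_pair:
  assumes "set bs \<subseteq> twists" "\<not> set bs \<subseteq> range t"
  shows "\<exists>gs. as @ [t i, t (nxt i)] @ bs \<sim> gs \<and> total_len gs < total_len (as @ [t i, t (nxt i)] @ bs)"
proof -
  obtain g where "g \<in> set bs" "g \<notin> range t" using assms(2) by blast
  then obtain b1 b2 where bs: "bs = b1 @ g # b2" by (meson split_list)
  have sub: "set b1 \<subseteq> carrier G" "g \<in> carrier G" "g \<in> twists" using assms(1) bs twists_closed by auto
  obtain j where j: "len (conjugate (t j) g) < len g" using shorten sub(3) \<open>g \<notin> range t\<close> by blast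
  let ?p = "[t i, t (nxt i)]" and ?b = "map (conjugate \<delta>) b1"
  have pair: "?p \<sim> [t (prv j), t j]" using atom_pair_turn[of i "prv j"] by simp
  have "?p @ b1 \<sim> ?b @ ?p" using sub by (intro slide_atom_pair)
  also have "?b @ ?p \<sim> ?b @ [t (prv j), t j]" using pair by (intro hurwitz_append) auto
  finally have "as @ (?p @ b1) @ g # b2 \<sim> as @ (?b @ [t (prv j), t j]) @ g # b2"
    by (rule hurwitz_context)
  also have "\<dots> = (as @ ?b @ [t (prv j)]) @ [t j, g] @ b2" by simp
  also have "\<dots> \<sim> (as @ ?b @ [t (prv j)]) @ [conjugate (t j) g, t j] @ b2"
    using sub by (intro hurwitz_context hurwitz_pair) auto
  finally have "as @ ?p @ bs \<sim> (as @ ?b @ [t (prv j)]) @ [conjugate (t j) g, t j] @ b2"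
    by (simp add: bs)
  moreover have "sum_list (map len ?b) = sum_list (map len b1)"
    using sub(1) by (induction b1) auto
  then have "total_len ((as @ ?b @ [t (prv j)]) @ [conjugate (t j) g, t j] @ b2) < total_len (as @ ?p @ bs)"
    using j by (simp add: total_len_def bs)
  ultimately show ?thesis by blast
qed

lemma reduce_total_len:
  assumes gs: "set gs \<subseteq> twists" "\<not> set gs \<subseteq> range t" and le: "len (prod_list gs) \<le> length gs"
  shows "\<exists>hs. gs \<sim> hs \<and> total_len hs < total_len gs"
proof -
  have "\<not> successively (\<lambda>g h. max (len g) (len h) < len (g \<otimes> h)) gs"
    using chain_atoms gs le by blast
  then obtain as g h bs where dec: "gs = as @ [g, h] @ bs" "\<not> max (len g) (len h) < len (g \<otimes> h)"
    by (rule not_successively_obtain)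
  have gh: "g \<in> twists" "h \<in> twists" and c: "g \<in> carrier G" "h \<in> carrier G" using gs dec twists_closed by auto
  have "len (g \<otimes> h) \<noteq> max (len g) (len h)"
    using even_len_twist_mult[OF gh] len_twist(1) gh by (metis max_def)
  then have "len (g \<otimes> h) < max (len g) (len h)" using dec(2) by linarith
  then consider i where "g = t i" "h = t (nxt i)" | "len (conjugate g h) < len h" | "len (conjugate (inv h) g) < len g"
    using short_product gh by blast
  then show ?thesis
  proof cases
    case (1 i)
    let ?p = "[t i, t (nxt i)]" and ?as = "map (conjugate (inv \<delta>)) as"
    have as: "set as \<subseteq> carrier G" using gs dec twists_closed by auto
    then have mm: "map (conjugate \<delta>) ?as = as"
      unfolding map_map by (intro map_idI) auto
    \<comment> \<open>The pair first moves to the left end, so that every factor that is not an atom is to its right.\<close>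
    have "?p @ ?as \<sim> as @ ?p" using slide_atom_pair[of ?as i] as mm by fastforce
    then have "as @ ?p \<sim> ?p @ ?as" by (rule hurwitz.sym)
    then have sim: "gs \<sim> [] @ ?p @ ?as @ bs"
      using hurwitz_append[of "as @ ?p" "?p @ ?as" bs bs] by (simp add: dec 1)
    have "conjugate (inv \<delta>) a \<in> twists" if "a \<in> set as" for a
      using that gs dec as twists_conjugate_iff[of "inv \<delta>" a] by auto
    then have twists: "set (?as @ bs) \<subseteq> twists" using gs dec by auto
    have "\<not> set (?as @ bs) \<subseteq> range t"
    proof
      assume atoms: "set (?as @ bs) \<subseteq> range t"
      have "a \<in> range t" if "a \<in> set as" for a
      proof -
        have "conjugate (inv \<delta>) a \<in> range t" using that atoms by auto
        then have "conjugate \<delta> (conjugate (inv \<delta>) a) \<in> range t" by auto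
        then show ?thesis using that as by auto
      qed
      then show False using gs atoms dec 1 by auto
    qed
    from shorten_next_to_pair[OF twists this, of "[]" i]
    obtain hs where "[] @ ?p @ ?as @ bs \<sim> hs" "total_len hs < total_len ([] @ ?p @ ?as @ bs)" by auto
    moreover have "sum_list (map len ?as) = sum_list (map len as)"
      using as by (induction as) auto
    ultimately show ?thesis using sim hurwitz.trans
      by (intro exI[of _ hs]) (auto simp: total_len_def dec 1)
  next
    case 2
    then show ?thesis using hurwitz_context[OF hurwitz_pair(1)[OF c], of as bs]
      by (intro exI[of _ "as @ [conjugate g h, g] @ bs"]) (simp add: dec total_len_def)
  next
    case 3
    then show ?thesis using hurwitz_context[OF hurwitz_pair(2)[OF c], of as bs]
      by (intro exI[of _ "as @ [h, conjugate (inv h) g] @ bs"]) (simp add: dec total_len_def)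
  qed
qed

lemma hurwitz_atoms:
  assumes "set gs \<subseteq> twists" "len (prod_list gs) \<le> length gs"
  shows "\<exists>w. gs \<sim> map t w"
  using assms
proof (induction "total_len gs" arbitrary: gs rule: less_induct)
  case less
  show ?case
  proof (cases "set gs \<subseteq> range t")
    case True
    then have "\<exists>w. gs = map t w" by (simp add: ex_map_conv) blast
    then show ?thesis by auto
  next
    case False
    then obtain hs where hs: "gs \<sim> hs" "total_len hs < total_len gs"
      using reduce_total_len less.prems by blast
    have "set hs \<subseteq> twists" using hurwitz_conjugate_closed[OF hs(1), of twists] twists_conjugate_iff less.prems by blast
    moreover have "set gs \<subseteq> carrier G" using less.prems twists_closed by blast
    then have "prod_list hs = prod_list gs" using hurwitz_prod[OF hs(1)] by simp
    ultimately obtain w where "hs \<sim> map t w"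
      using less.hyps[OF hs(2)] less.prems hurwitz_length[OF hs(1)] by auto
    then show ?thesis using hs(1) hurwitz.trans by blast
  qed
qed

section \<open>Tuples of atoms\<close>

definition delta_pairs :: "nat \<Rightarrow> 'a list" where
  "delta_pairs q = concat (replicate q [t A, t B])"

lemma delta_pairs_simps [simp]: "delta_pairs 0 = []" "delta_pairs (Suc q) = [t A, t B] @ delta_pairs q"
  by (simp_all add: delta_pairs_def)

lemma delta_pairs_closed [simp]: "set (delta_pairs q) \<subseteq> carrier G"
  by (induction q) auto

lemma slide_pairs: "t i # delta_pairs q \<sim> delta_pairs q @ [t ((prv ^^ q) i)]"
proof (induction q arbitrary: i)
  case (Suc q)
  have "[t A, t (nxt A)] @ [t (prv i)] \<sim> [t i] @ [t A, t (nxt A)]"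
    using slide_atom_pair[of "[t (prv i)]" A] by simp
  then have "[t i, t A, t B] @ delta_pairs q \<sim> [t A, t B, t (prv i)] @ delta_pairs q"
    by (intro hurwitz_append) (auto intro: hurwitz.sym)
  also have "[t A, t B, t (prv i)] @ delta_pairs q = [t A, t B] @ (t (prv i) # delta_pairs q)" by simp
  also have "\<dots> \<sim> [t A, t B] @ (delta_pairs q @ [t ((prv ^^ q) (prv i))])"
    by (intro hurwitz_append Suc) simp
  finally show ?case by (simp add: funpow_Suc_right del: funpow.simps(2))
qed simp

text \<open>
  The Garside normal form, obtained by Hurwitz moves: every product \<open>\<delta>\<close> of two neighbouring atoms is
  moved to the left and turned into the standard pair.
\<close>

lemma hurwitz_normal_form: "\<exists>q v. reduced v \<and> map t w \<sim> delta_pairs q @ map t v"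
proof (induction w)
  case Nil
  have "reduced [] \<and> map t [] \<sim> delta_pairs 0 @ map t []" by simp
  then show ?case by blast
next
  case (Cons i w)
  then obtain q v where v: "reduced v" "map t w \<sim> delta_pairs q @ map t v" by blast
  define j where "j = (prv ^^ q) i"
  have "map t (i # w) \<sim> (t i # delta_pairs q) @ map t v"
    using hurwitz_Cons[OF v(2), of "t i"] by simp
  also have "\<dots> \<sim> (delta_pairs q @ [t j]) @ map t v"
    unfolding j_def by (intro hurwitz_append slide_pairs) simp
  finally have sim: "map t (i # w) \<sim> delta_pairs q @ map t (j # v)" by simp
  show ?case
  proof (cases "reduced (j # v)")
    case True
    then show ?thesis using sim by blast
  next
    case False
    then obtain u where u: "v = nxt j # u" using v by (cases v) auto
    have "delta_pairs (Suc q) = delta_pairs q @ [t A, t B]"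
      by (induction q) auto
    then have "delta_pairs q @ [t j, t (nxt j)] @ map t u \<sim> delta_pairs (Suc q) @ map t u"
      using hurwitz_context[OF atom_pair_turn[of j A], of "delta_pairs q" "map t u"] by simp
    then have "map t (i # w) \<sim> delta_pairs (Suc q) @ map t u"
      using hurwitz.trans[OF sim[unfolded u]] by simp
    moreover have "reduced u" using v u by (simp add: reduced_Cons)
    ultimately show ?thesis by blast
  qed
qed

text \<open>
  The number of letters of \<open>v\<close> and, once \<open>q\<close> is known, the word \<open>v\<close> can be read off from the image of
  the root; so a tuple in normal form is determined by its length and its product.
\<close>

lemma act_prod_normal_form:
  "reduced v \<Longrightarrow> act (prod_list (delta_pairs q @ map t v)) [] = (map nxt ^^ q) v"
proof -
  assume v: "reduced v"
  have "reduced ((map nxt ^^ q) v) \<and> act (prod_list (delta_pairs q)) v = (map nxt ^^ q) v"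
  proof (induction q)
    case (Suc q)
    have "prod_list (delta_pairs (Suc q)) = \<delta> \<otimes> prod_list (delta_pairs q)"
      by (simp add: \<delta>_def m_assoc)
    then show ?case using Suc v by simp
  qed (use v in simp)
  moreover have "prod_list (delta_pairs q @ map t v) = prod_list (delta_pairs q) \<otimes> word v"
    unfolding word_def by (intro prod_list_append) auto
  ultimately show ?thesis using v act_word[of v "[]"] by simp
qed

text \<open>
  In the braid group, the bound on the length says that the product is a positive word in the atoms:
  a braid \<open>\<delta>\<^sup>p w\<close> with a reduced word \<open>w\<close> of \<open>n\<close> atoms has length \<open>n\<close> and exponent sum \<open>2 p + n\<close>, and a
  product of \<open>k\<close> conjugates of an atom has exponent sum \<open>k\<close>; so the bound \<open>n \<le> k\<close> means \<open>p \<ge> 0\<close>.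
\<close>

theorem hurwitz_equivalence_of_factorizations:
  assumes "set gs \<subseteq> twists" "set hs \<subseteq> twists" "prod_list gs = prod_list hs" "length gs = length hs"
    "len (prod_list gs) \<le> length gs"
  shows "gs \<sim> hs"
proof -
  have nf: "\<exists>q v. reduced v \<and> xs \<sim> delta_pairs q @ map t v \<and> act (prod_list xs) [] = (map nxt ^^ q) v \<and>
      length xs = 2 * q + length v"
    if xs: "set xs \<subseteq> twists" "len (prod_list xs) \<le> length xs" for xs
  proof -
    obtain w where "xs \<sim> map t w" using hurwitz_atoms xs by blast
    then obtain q v where v: "reduced v" "xs \<sim> delta_pairs q @ map t v"
      using hurwitz_normal_form hurwitz.trans by meson
    moreover have "set xs \<subseteq> carrier G" using xs twists_closed by blast
    then have "prod_list xs = prod_list (delta_pairs q @ map t v)" by (rule hurwitz_prod[OF v(2)])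
    moreover have "length (delta_pairs q) = 2 * q" by (induction q) auto
    then have "length xs = 2 * q + length v" using hurwitz_length[OF v(2)] by simp
    ultimately show ?thesis using act_prod_normal_form by metis
  qed
  obtain q v where v: "gs \<sim> delta_pairs q @ map t v" "act (prod_list gs) [] = (map nxt ^^ q) v"
      "length gs = 2 * q + length v" using nf[of gs] assms by blast
  obtain p u where u: "hs \<sim> delta_pairs p @ map t u" "act (prod_list hs) [] = (map nxt ^^ p) u"
      "length hs = 2 * p + length u" using nf[of hs] assms by auto
  have eq: "(map nxt ^^ q) v = (map nxt ^^ p) u" using u v assms by simp
  have "length ((map nxt ^^ n) w) = length w" for n w by (induction n) auto
  with eq have "length v = length u" by metis
  then have "q = p" using u v assms by simp
  moreover have "inj (map nxt ^^ p)" by (intro inj_fn) (simp add: inj_nxt)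
  ultimately have "v = u" using eq by (simp add: inj_eq)
  then show ?thesis using u v \<open>q = p\<close> hurwitz.trans hurwitz.sym by metis
qed

end

section \<open>The braid group on three strings\<close>

lemma braid_of_closed [simp]: "w \<in> words {1..<n} \<Longrightarrow> braid_of n w \<in> carrier (braid_group n)"
  by (simp add: braid_group_def braid_of_def carrier_presented_group)

lemma braid_of_mult:
  "v \<in> words {1..<n} \<Longrightarrow> w \<in> words {1..<n} \<Longrightarrow>
     braid_of n v \<otimes>\<^bsub>braid_group n\<^esub> braid_of n w = braid_of n (v @ w)"
  by (simp add: braid_group_def braid_of_def mult_presented_group)

lemma braid_of_Nil: "braid_of n [] = \<one>\<^bsub>braid_group n\<^esub>"
  by (simp add: braid_group_def braid_of_def one_presented_group)

lemma carrier_braid_group: "carrier (braid_group n) = braid_of n ` words {1..<n}"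
  by (simp add: braid_group_def braid_of_def carrier_presented_group)

lemma inv_\<sigma>:
  assumes "i \<in> {1..<n}"
  shows "inv\<^bsub>braid_group n\<^esub> (\<sigma> n i) = braid_of n [(i, False)]"
proof (rule group.inv_equality[OF group_braid_group])
  have "pres_eq {1..<n} (braid_relations n) ([] @ [(i, False), (i, \<not> False)] @ []) ([] @ [])"
    using assms by (intro pres_eq.cancel) auto
  then have "braid_of n [(i, False), (i, True)] = braid_of n []"
    by (simp add: braid_of_def pres_class_eq_iff)
  then show "braid_of n [(i, False)] \<otimes>\<^bsub>braid_group n\<^esub> \<sigma> n i = \<one>\<^bsub>braid_group n\<^esub>"
    using assms by (simp add: braid_of_mult braid_of_Nil)
qed (use assms in auto)

text \<open>
  The exponent sum recovers the number of factors of a quasipositive factorization from its product.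
\<close>

definition exponent_sum :: "nat \<Rightarrow> nat word set \<Rightarrow> int" where
  "exponent_sum n = induced_hom integer_group (\<lambda>_. 1)"

lemma exponent_sum_hom: "group_hom (braid_group n) integer_group (exponent_sum n)"
proof -
  have "induced_hom integer_group (\<lambda>_. 1) \<in> hom (presented_group {1..<n} (braid_relations n)) integer_group"
    by (intro group.induced_hom_hom) (auto simp: braid_relations_def)
  then show ?thesis
    by (simp add: group_hom_def group_hom_axioms_def group_braid_group exponent_sum_def braid_group_def
        group_presented_group)
qed

lemma exponent_sum_positive:
  assumes "is \<in> lists {1..<n}"
  shows "exponent_sum n (braid_of n (map (\<lambda>i. (i, True)) is)) = int (length is)"
proof -
  have "exponent_sum n (braid_of n (map (\<lambda>i. (i, True)) is)) =
      eval_word integer_group (\<lambda>_. 1) (map (\<lambda>i. (i, True)) is)"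
    unfolding exponent_sum_def braid_of_def using assms
    by (intro group.induced_hom_pres_class) (auto simp: braid_relations_def words_def)
  also have "\<dots> = int (length is)" by (induction "is") auto
  finally show ?thesis .
qed

definition tree_gen :: "nat \<Rightarrow> atom list \<Rightarrow> atom list" where
  "tree_gen i = restrict (push (if i = 1 then A else B)) {w. reduced w}"

definition tree_act :: "nat word set \<Rightarrow> atom list \<Rightarrow> atom list" where
  "tree_act = induced_hom (BijGroup {w. reduced w}) tree_gen"

lemma tree_gen_Bij: "tree_gen i \<in> Bij {w. reduced w}"
  using bij_betw_push by (auto simp: Bij_def tree_gen_def)

text \<open>
  Both sides of the braid relation consist of \<open>\<delta> = \<sigma>\<^sub>1 \<sigma>\<^sub>2\<close> and one more generator: \<open>\<sigma>\<^sub>1 \<sigma>\<^sub>2 \<sigma>\<^sub>1 = \<delta> \<sigma>\<^sub>1\<close> and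
  \<open>\<sigma>\<^sub>2 \<sigma>\<^sub>1 \<sigma>\<^sub>2 = \<sigma>\<^sub>2 \<delta>\<close>, and the rotation \<open>map nxt\<close> intertwines \<open>push A\<close> with \<open>push B\<close>.
\<close>

lemma tree_gen_respects:
  assumes "(l, r) \<in> braid_relations 3"
  shows "eval_word (BijGroup {w. reduced w}) tree_gen l = eval_word (BijGroup {w. reduced w}) tree_gen r"
proof -
  let ?T = "{w. reduced w}"
  have lr: "l = [(1, True), (2, True), (1, True)]" "r = [(2, True), (1, True), (2, True)]"
    using assms by (auto simp: braid_relations_def numeral_eq_Suc)
  have "push A (push B (push A w)) = push B (push A (push B w))" if "reduced w" for w
  proof -
    have "push A (push B (push A w)) = map nxt (push A w)"
      using push_push_nxt[of "push A w" A] that by simp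
    also have "\<dots> = push B (map nxt w)" using map_nxt_push[of A w] by simp
    also have "\<dots> = push B (push A (push B w))" using push_push_nxt[of w A] that by simp
    finally show ?thesis .
  qed
  then have "compose ?T (tree_gen 1) (compose ?T (tree_gen 2) (tree_gen 1)) =
      compose ?T (tree_gen 2) (compose ?T (tree_gen 1) (tree_gen 2))"
    by (intro extensionalityI[OF compose_extensional compose_extensional])
       (auto simp: compose_eq tree_gen_def)
  moreover have "compose ?T (tree_gen i) (\<lambda>w \<in> ?T. w) = tree_gen i" for i
    by (auto simp: compose_def tree_gen_def fun_eq_iff)
  ultimately show ?thesis
    unfolding lr using tree_gen_Bij by (simp add: BijGroup_def compose_Bij id_Bij)
qed

lemma group_action_tree: "group_action (braid_group 3) {w. reduced w} tree_act"
proof -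
  have "tree_act \<in> hom (presented_group {1..<3} (braid_relations 3)) (BijGroup {w. reduced w})"
    unfolding tree_act_def using tree_gen_respects tree_gen_Bij
    by (intro group.induced_hom_hom group_BijGroup) (auto simp: BijGroup_def)
  then show ?thesis
    unfolding group_action_def group_hom_def group_hom_axioms_def
    using group_braid_group[of 3] group_BijGroup by (simp add: braid_group_def)
qed

lemma tree_act_generator:
  assumes "i \<in> {1..<3}" "reduced w"
  shows "tree_act (\<sigma> 3 i) w = push (if i = 1 then A else B) w"
proof -
  interpret T: group "BijGroup {w. reduced w}" by (rule group_BijGroup)
  have "tree_gen i \<in> carrier (BijGroup {w. reduced w})"
    using tree_gen_Bij by (simp add: BijGroup_def)
  moreover have "induced_hom (BijGroup {w. reduced w}) tree_gen
      (pres_class {1..<3} (braid_relations 3) [(i, True)]) =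
    eval_word (BijGroup {w. reduced w}) tree_gen [(i, True)]"
    using assms tree_gen_respects tree_gen_Bij
    by (intro T.induced_hom_pres_class) (auto simp: BijGroup_def)
  ultimately show ?thesis
    using assms(2) by (simp add: tree_act_def braid_of_def tree_gen_def)
qed

text \<open>
  The Birman-Ko-Lee generators.  The choice of \<open>band C\<close> is dictated by
  \<open>band B \<otimes> band C = band A \<otimes> band B\<close>; then \<open>band C \<otimes> band A = band A \<otimes> band B\<close> is the braid relation.
\<close>

fun band :: "atom \<Rightarrow> nat word set" where
  "band A = \<sigma> 3 1"
| "band B = \<sigma> 3 2"
| "band C = inv\<^bsub>braid_group 3\<^esub> (\<sigma> 3 2) \<otimes>\<^bsub>braid_group 3\<^esub> (\<sigma> 3 1 \<otimes>\<^bsub>braid_group 3\<^esub> \<sigma> 3 2)"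

interpretation B3: group "braid_group 3"
  by (rule group_braid_group)

lemma \<sigma>_closed: "\<sigma> 3 1 \<in> carrier (braid_group 3)" "\<sigma> 3 2 \<in> carrier (braid_group 3)"
  by simp_all

lemma band_closed: "band i \<in> carrier (braid_group 3)"
  using \<sigma>_closed by (cases i) auto

lemma braid_relation:
  "\<sigma> 3 1 \<otimes>\<^bsub>braid_group 3\<^esub> (\<sigma> 3 2 \<otimes>\<^bsub>braid_group 3\<^esub> \<sigma> 3 1) =
   \<sigma> 3 2 \<otimes>\<^bsub>braid_group 3\<^esub> (\<sigma> 3 1 \<otimes>\<^bsub>braid_group 3\<^esub> \<sigma> 3 2)"
proof -
  have "([(1, True), (1 + 1, True), (1, True)], [(1 + 1, True), (1, True), (1 + 1, True)])
      \<in> braid_relations 3"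
    unfolding braid_relations_def by (intro UnI1) fastforce
  then have "pres_eq {1..<3} (braid_relations 3) ([] @ [(1, True), (1 + 1, True), (1, True)] @ [])
      ([] @ [(1 + 1, True), (1, True), (1 + 1, True)] @ [])"
    by (intro pres_eq.relator) auto
  then have "braid_of 3 [(1, True), (2, True), (1, True)] = braid_of 3 [(2, True), (1, True), (2, True)]"
    by (simp add: braid_of_def pres_class_eq_iff numeral_2_eq_2)
  then show ?thesis by (simp add: braid_of_mult)
qed

lemma band_mult: "band i \<otimes>\<^bsub>braid_group 3\<^esub> band (nxt i) = band A \<otimes>\<^bsub>braid_group 3\<^esub> band B"
proof (cases i)
  case C
  have "band C \<otimes>\<^bsub>braid_group 3\<^esub> \<sigma> 3 1 =
      inv\<^bsub>braid_group 3\<^esub> (\<sigma> 3 2) \<otimes>\<^bsub>braid_group 3\<^esub>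
        (\<sigma> 3 1 \<otimes>\<^bsub>braid_group 3\<^esub> (\<sigma> 3 2 \<otimes>\<^bsub>braid_group 3\<^esub> \<sigma> 3 1))"
    using \<sigma>_closed by (simp add: B3.m_assoc)
  then show ?thesis using \<sigma>_closed C braid_relation by simp
qed (use \<sigma>_closed in auto)

lemma band_generate: "carrier (braid_group 3) = generate (braid_group 3) (range band)"
proof (intro equalityI subsetI)
  fix X assume "X \<in> carrier (braid_group 3)"
  then obtain w where w: "w \<in> words {1..<3}" "X = braid_of 3 w" by (auto simp: carrier_braid_group)
  have "braid_of 3 w \<in> generate (braid_group 3) (range band)" using w(1)
  proof (induction w)
    case Nil
    then show ?case by (simp add: braid_of_Nil generate.one)
  next
    case (Cons x w)
    obtain i b where x: "x = (i, b)" by (cases x)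
    have i: "i \<in> {1..<3}" using Cons.prems x by simp
    then have "i = 1 \<or> i = 2" by auto
    then have \<sigma>: "\<sigma> 3 i \<in> range band" by (metis band.simps(1,2) rangeI)
    have "braid_of 3 [x] \<in> generate (braid_group 3) (range band)"
      using inv_\<sigma>[OF i] generate.incl[OF \<sigma>] generate.inv[OF \<sigma>, of "braid_group 3"] x by (cases b) auto
    moreover have "braid_of 3 (x # w) = braid_of 3 [x] \<otimes>\<^bsub>braid_group 3\<^esub> braid_of 3 w"
      using Cons.prems by (simp add: braid_of_mult)
    ultimately show ?case using Cons generate.eng by fastforce
  qed
  then show "X \<in> generate (braid_group 3) (range band)" using w by simp
next
  fix X assume "X \<in> generate (braid_group 3) (range band)"
  then show "X \<in> carrier (braid_group 3)"
    by (induction rule: generate.induct) (auto simp: band_closed)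
qed

lemma tree_act_band: "reduced w \<Longrightarrow> tree_act (band i) w = push i w"
proof -
  interpret T: group_action "braid_group 3" "{w. reduced w}" tree_act by (rule group_action_tree)
  have AB: "tree_act (band A) v = push A v" "tree_act (band B) v = push B v" if "reduced v" for v
    using tree_act_generator[of 1 v] tree_act_generator[of 2 v] that by auto
  assume w: "reduced w"
  show ?thesis
  proof (cases i)
    case C
    have red: "reduced (tree_act (band C) w)"
      using T.element_image[OF band_closed[of C]] w by blast
    \<comment> \<open>Compare both sides after applying the injective map \<open>push B\<close>, which turns them into \<open>\<delta>\<close>.\<close>
    have "push B (tree_act (band C) w) = tree_act (band B \<otimes>\<^bsub>braid_group 3\<^esub> band C) w"
      using red w AB band_closed T.composition_rule[of w "band B" "band C"] by simp
    also have "\<dots> = tree_act (band A \<otimes>\<^bsub>braid_group 3\<^esub> band B) w"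
      using band_mult[of B] by simp
    also have "\<dots> = push A (push B w)"
      using w AB band_closed T.composition_rule[of w "band A" "band B"] by simp
    also have "\<dots> = push B (push C w)"
      using w push_push_nxt[of w A] push_push_nxt[of w B] by simp
    finally have "push B (tree_act (band C) w) = push B (push C w)" .
    then show ?thesis
      using bij_betw_imp_inj_on[OF bij_betw_push[of B]] red w C by (auto dest: inj_onD)
  qed (use w AB in auto)
qed

interpretation B3: atom_group "braid_group 3" band tree_act
  by (intro atom_group.intro atom_group_axioms.intro group_braid_group group_action_tree
      band_closed tree_act_band band_generate band_mult)

lemma factorization_conjugates:
  assumes "quasipositive_factorization X Xs"
  shows "set Xs \<subseteq> B3.twists" "B3.prod_list Xs = X" "exponent_sum 3 X = int (length Xs)"
proof -
  show twists: "set Xs \<subseteq> B3.twists"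
    using assms by (auto simp: quasipositive_factorization_def conjugate_in_def B3.twists_def B3.conjugate_def)
  show X: "B3.prod_list Xs = X"
    using assms by (simp add: quasipositive_factorization_def B3.prod_list_def)
  interpret E: group_hom "braid_group 3" integer_group "exponent_sum 3"
    by (rule exponent_sum_hom)
  have "exponent_sum 3 (\<sigma> 3 1) = 1"
    using exponent_sum_positive[of "[1]" 3] by simp
  then have "exponent_sum 3 g = 1" if "g \<in> B3.twists" for g
    using that \<sigma>_closed by (auto simp: B3.twists_def B3.conjugate_def)
  then have "set Xs \<subseteq> B3.twists \<Longrightarrow> exponent_sum 3 (B3.prod_list Xs) = int (length Xs)"
    using B3.twists_closed by (induction Xs) (auto simp: subset_iff)
  then show "exponent_sum 3 X = int (length Xs)" using twists X by simp
qed

text \<open>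
  This is where positivity enters: each letter of a positive word adds 1 to the exponent sum and at
  most 1 to the length.
\<close>

lemma len_positive_braid:
  assumes "positive_braid 3 X"
  shows "int (B3.len X) \<le> exponent_sum 3 X"
proof -
  obtain "is" where "is": "is \<in> lists {1..<3}" "X = braid_of 3 (map (\<lambda>i. (i, True)) is)"
    using assms by (auto simp: positive_braid_def)
  have "braid_of 3 (map (\<lambda>i. (i, True)) is) = B3.word (map (\<lambda>i. if i = 1 then A else B) is)"
    using "is"(1)
  proof (induction "is")
    case (Cons i "is")
    then have "i = 1 \<or> i = 2" by auto
    then have "\<sigma> 3 i = band (if i = 1 then A else B)" by auto
    moreover have "map (\<lambda>i. (i, True)) is \<in> words {1..<3}" using Cons by (auto simp: words_def)
    then have "braid_of 3 (map (\<lambda>i. (i, True)) (i # is)) =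
        \<sigma> 3 i \<otimes>\<^bsub>braid_group 3\<^esub> braid_of 3 (map (\<lambda>i. (i, True)) is)"
      using Cons by (subst braid_of_mult) auto
    ultimately show ?case using Cons by simp
  qed (simp add: braid_of_Nil)
  then have "B3.len X \<le> length is"
    using "is"(2) B3.len_word_le[of "map (\<lambda>i. if i = 1 then A else B) is"] by simp
  then show ?thesis
    using "is" exponent_sum_positive[OF "is"(1)] by simp
qed

theorem corollary3:
  fixes X :: "nat word set" and Xs Ys :: "nat word set list"
  assumes "X \<in> carrier (braid_group 3)"
    and "positive_braid 3 X"
    and "quasipositive_factorization X Xs"
    and "quasipositive_factorization X Ys"
  shows "hurwitz_equivalent (braid_group 3) Xs Ys"
proof -
  note Xs = factorization_conjugates[OF assms(3)] and Ys = factorization_conjugates[OF assms(4)]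
  have "B3.hurwitz Xs Ys"
    using Xs Ys len_positive_braid[OF assms(2)]
    by (intro B3.hurwitz_equivalence_of_factorizations) auto
  then show ?thesis
    using assms(3) by (intro B3.hurwitz_equivalent_if_hurwitz) (auto simp: quasipositive_factorization_def)
qed

end
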